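(* Suppose $\cdot\,;L\vdash P\triangleright\Delta$ is derivable in the liveness typing system (with empty process variable environment) and $P$ is lock-free. Then $P$ is live with respect to $\cdot,\Delta$: for every maximal transition sequence $(P_i,\lambda_i)_i$ of $P$ there is a live transition sequence $(\Delta_i,\delta_i)_i$ of $\Delta$ such that $((P_i,\Delta_i),(\lambda_i,\delta_i))_i$ is a typed transition sequence of $\cdot\vdash_{\mathsf{std}}P\triangleright\Delta$.
   Context: **Processes.** Channel names $c$; polarised channel names $c^+,c^-$, ranged over by $k,h$, with $\overline{c^+}=c^-$, $\overline{c^-}=c^+$. Data variables $x,i$; values $v$ (including naturals and $\mathsf{true},\mathsf{false}$); expressions $e$ (including variables and values); labels $l\in\mathcal L$ (countably infinite); process variables $X,Y$. Evaluation $e\Downarrow v$ is a total function; conditions evaluate to booleans and bounds $e$ in $\mathrm{rec}^e$ to naturals. Syntax: $$P::=k!\langle e\rangle.P\mid k?(x).P\mid k!l.P\mid k?\{l_i.P_i\}_{i\in I}\mid\mathbf 0\mid P|Q\mid\mathrm{rec}\,X.P\mid(\mathrm{rec}^e X(i).P;Q)\mid X[\tilde k]\mid\mathsf{if}\ e\ \mathsf{then}\ P\ \mathsf{else}\ Q$$ ($I$ finite non-empty; $\tilde k$ a finite collection of polarised names). $x$ binds in $k?(x).P$; $X$ in $\mathrm{rec}\,X.P$; $X,i$ bind in the body $P$ of $(\mathrm{rec}^e X(i).P;Q)$. Convention: the body $P$ of $(\mathrm{rec}^eX(i).P;Q)$ contains no $\mathbf 0$, no free process variable other than $X$, no sub-term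 $\mathrm{rec}\,Y.R$ or $(\mathrm{rec}^{e'}Y(j).R;S)$, and no sub-term $R|S$. $\mathsf{fn}(P)$ is the set of free polarised names, with $\mathsf{fn}(X[\tilde k])=\tilde k$. Substitutions are capture-avoiding; $X[\tilde k]\{Q/X\}=Q$. **Process transitions.** Labels $\lambda::=k!v\mid k?v\mid k\oplus l\mid k\& l\mid\tau\mid\tau{:}l$. $\mathsf{subj}$ of the first four is $k$; $\mathsf{subj}(\tau)=\mathsf{subj}(\tau{:}l)=\tau$; $\overline\tau=\tau$, not a channel. Rules: - Prefixes: $k!\langle e\rangle.P\xrightarrow{k!v}P$ if $e\Downarrow v$; $k?(x).P\xrightarrow{k?v}P\{v/x\}$; $k!l.P\xrightarrow{k\oplus l}P$ (each if $\overline k\notin\mathsf{fn}(P)$); $k?\{l_i.P_i\}_{i\in I}\xrightarrow{k\&l_i}P_i$ if $\overline k\notin\mathsf{fn}(P_i)$. - Par: if $P\xrightarrow{\lambda}Q$ and $\overline{\mathsf{subj}(\lambda)}\notin\mathsf{fn}(P')$ then $P|P'\xrightarrow{\lambda}Q|P'$; and symmetrically. - Com: if $P\xrightarrow{\overline k!v}P'$, $Q\xrightarrow{k?v}Q'$ then $P|Q\xrightarrow{\tau}P'|Q'$; if $P\xrightarrow{\overline k\oplus l}P'$, $Q\xrightarrow{k\&l}Q'$ then $P|Q\xrightarrow{\tau:l}P'|Q'$; and symmetrically. - Rec: if $P\{\mathrm{rec}\,X.P/X\}\xrightarrow{\lambda}Q$ then $\mathrm{rec}\,X.P\xrightarrow{\lambda}Q$.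 - Bounded rec: if $e\Downarrow0$ and $Q\xrightarrow{\lambda}R$, or $e\Downarrow n+1$ and $P\{n/i\}\{(\mathrm{rec}^nX(i).P;Q)/X\}\xrightarrow{\lambda}R$, then $(\mathrm{rec}^eX(i).P;Q)\xrightarrow{\lambda}R$. - Cond: $\mathsf{if}\ e\ \mathsf{then}\ P\ \mathsf{else}\ Q$ has the transitions of $P$ if $e\Downarrow\mathsf{true}$, of $Q$ if $e\Downarrow\mathsf{false}$. **Types.** $S,T::=\&\{l_i[L_i].T_i\}_{i\in I}\mid\oplus\{l_i[L_i].T_i\}_{i\in I}\mid\ !.T\mid\ ?.T\mid\mu t.T\mid t\mid\mathtt{end}$, $L_i\subseteq\mathcal L$, labels in each $\&,\oplus$ distinct; closed, contractive, identified with their infinite unfoldings. Transitions with labels $\rho::=!\mid?\mid\&l[L]\mid\oplus l[L]$: $!.T\xrightarrow{!}T$, $?.T\xrightarrow{?}T$, $\&\{l_i[L_i].T_i\}_{i\in I}\xrightarrow{\&l_i[L_i]}T_i$, $\oplus\{l_i[L_i].T_i\}_{i\in I}\xrightarrow{\oplus l_i[L_i]}T_i$. **Session environments.** $\Delta$ is a finite partial map from polarised channel names to types; $\Delta,\Delta'$ is union, defined for disjoint domains. $\Delta$ is completed if all its types are $\mathtt{end}$. Transitions, labels $\delta::=\tau\mid\tau{:}l,L\mid k{:}\rho$: if $T\xrightarrow{\rho}T'$ then $k{:}T\xrightarrow{k:\rho}k{:}T'$; if $\Delta\xrightarrow{\delta}\Delta'$ then $\Delta,\Delta''\xrightarrow{\delta}\Delta',\Delta''$;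 if $\Delta_1\xrightarrow{k:!}\Delta_1'$ and $\Delta_2\xrightarrow{\overline k:?}\Delta_2'$ then $\Delta_1,\Delta_2\xrightarrow{\tau}\Delta'_1,\Delta'_2$; if $\Delta_1\xrightarrow{k:\oplus l[L]}\Delta_1'$ and $\Delta_2\xrightarrow{\overline k:\&l[L']}\Delta_2'$ then $\Delta_1,\Delta_2\xrightarrow{\tau:l,L\cup L'}\Delta'_1,\Delta'_2$. $\mathsf{req}(\tau)=\mathsf{res}(\tau)=\mathsf{req}(k{:}!)=\mathsf{res}(k{:}!)=\mathsf{req}(k{:}?)=\mathsf{res}(k{:}?)=\emptyset$; for $\delta\in\{k{:}\&l[L],\,k{:}\oplus l[L],\,(\tau{:}l,L)\}$, $\mathsf{req}(\delta)=L$, $\mathsf{res}(\delta)=\{l\}$. A finite or infinite transition sequence with labels $\delta_1\delta_2\cdots$ is *live* iff for every $n$, $\mathsf{req}(\delta_n)\subseteq\bigcup_{m>n}\mathsf{res}(\delta_m)$. Correspondence $\delta\simeq\lambda$: $\tau\simeq\tau$; $(\tau{:}l,L)\simeq\tau{:}l$; $k{:}\&l[L]\simeq k\&l$; $k{:}\oplus l[L]\simeq k\oplus l$; $k{:}!\simeq k!v$; $k{:}?\simeq k?v$. **Liveness typing** $\Gamma;L\vdash P\triangleright\Delta$. $L\subseteq\mathcal L$; $\Gamma$ is a finite partial map from process variables to triples $(A,I,\Delta)$ (general recursion) or pairs $(L',\Delta)$ (bounded recursion), $A,I,L'\subseteq\mathcal L$. $\Gamma+l$ replaces each triple $(A,I,\Delta)$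 by $(A\cup\{l\},I,\Delta)$ and leaves pairs unchanged. Rules: - from $\Gamma;L\vdash P\triangleright\Delta,k{:}T$ infer $\Gamma;L\vdash k!\langle e\rangle.P\triangleright\Delta,k{:}!.T$ and $\Gamma;L\vdash k?(x).P\triangleright\Delta,k{:}?.T$; - if for all $i\in I$, $\Gamma+l_i;(L\setminus\{l_i\})\cup L_i\vdash P_i\triangleright\Delta,k{:}T_i$, then $\Gamma;L\vdash k?\{l_i.P_i\}_{i\in I}\triangleright\Delta,k{:}\&\{l_i[L_i].T_i\}_{i\in I}$; - if $j\in I$ and $\Gamma+l_j;(L\setminus\{l_j\})\cup L_j\vdash P\triangleright\Delta,k{:}T_j$, then $\Gamma;L\vdash k!l_j.P\triangleright\Delta,k{:}\oplus\{l_i[L_i].T_i\}_{i\in I}$; - if $\Gamma;L_1\vdash P_1\triangleright\Delta_1$ and $\Gamma;L_2\vdash P_2\triangleright\Delta_2$ then $\Gamma;L_1\cup L_2\vdash P_1|P_2\triangleright\Delta_1,\Delta_2$; - if $\Delta$ completed, $\Gamma;\emptyset\vdash\mathbf 0\triangleright\Delta$; - if $L\subseteq I\subseteq A$ and $\mathsf{dom}(\Delta)=\tilde k$, $\Gamma,X{:}(A,I,\Delta);L\vdash X[\tilde k]\triangleright\Delta$; - if $L\subseteq L'$ and $\mathsf{dom}(\Delta)=\tilde k$, $\Gamma,X{:}(L',\Delta);L\vdash X[\tilde k]\triangleright\Delta$; - if $\Gamma,X{:}(L',\Delta);L'\vdash P\triangleright\Delta$, $\Gamma;L'\vdash Q\triangleright\Delta$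 and $L\subseteq L'$, then $\Gamma;L\vdash(\mathrm{rec}^eX(i).P;Q)\triangleright\Delta$; - if $\Gamma,X{:}(\emptyset,I,\Delta);I\vdash P\triangleright\Delta$ and $L\subseteq I$, then $\Gamma;L\vdash\mathrm{rec}\,X.P\triangleright\Delta$; - if $\Gamma;L\vdash P\triangleright\Delta$ and $\Gamma;L\vdash Q\triangleright\Delta$ then $\Gamma;L\vdash\mathsf{if}\ e\ \mathsf{then}\ P\ \mathsf{else}\ Q\triangleright\Delta$. **Standard typing** $\Theta\vdash_{\mathsf{std}}P\triangleright\Delta$, where $\Theta$ maps process variables to session environments: the same rules with all $L$-components, the $+l$ operations and all label-set side conditions erased, and each triple $(A,I,\Delta)$ or pair $(L',\Delta)$ replaced by $\Delta$ (so e.g. $\Theta,X{:}\Delta\vdash_{\mathsf{std}}X[\tilde k]\triangleright\Delta$ if $\mathsf{dom}(\Delta)=\tilde k$). The *typed transition system* has states $\Theta\vdash_{\mathsf{std}}P\triangleright\Delta$ (derivable judgements) and a transition labelled $(\lambda,\delta)$ from $\Theta\vdash_{\mathsf{std}}P\triangleright\Delta$ to $\Theta\vdash_{\mathsf{std}}P'\triangleright\Delta'$ whenever $P\xrightarrow{\lambda}P'$, $\Delta\xrightarrow{\delta}\Delta'$ and $\delta\simeq\lambda$. **Occurrences, maximality, lock-freedom.** A transition sequence of $P$ is a finite $P=P_1\xrightarrow{\lambda_1}\cdots\xrightarrow{\lambda_{n-1}}P_n$ ($n\ge1$) or an infinite one; transitions in it are considered with their derivations. An *action* is a prefix (send, receive,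 select or branch). Top-level occurrences of actions in a process are identified by addresses $w\in\{\mathsf L,\mathsf R\}^*$, inductively: a prefixed process has one at the empty address; $P|Q$ has one at $\mathsf Lw$ for each address $w$ of $P$ and at $\mathsf Rw$ for each $w$ of $Q$; $\mathrm{rec}\,X.P$ has those of $P\{\mathrm{rec}\,X.P/X\}$; $(\mathrm{rec}^eX(i).P;Q)$ has those of $Q$ if $e\Downarrow0$ and those of $P\{n/i\}\{(\mathrm{rec}^nX(i).P;Q)/X\}$ if $e\Downarrow n+1$; a conditional has those of the chosen branch. A transition executes: the empty address (prefix rules); $\mathsf Lw$ (resp. $\mathsf Rw$) when the left (resp. right) component executes $w$ in Par; both $\mathsf Lw$ and $\mathsf Rw'$ in Com; the addresses executed by the premise in the recursion and conditional rules. A top-level occurrence not executed by a transition is preserved, at the same address. An occurrence is *enabled* in $P$ if some transition of $P$ executes it. An infinite transition sequence is *fair* iff every occurrence enabled in some $P_n$ is executed by $P_m\xrightarrow{\lambda_m}P_{m+1}$ for some $m\ge n$. A transition sequence is *maximal* iff it is finite with last process having no transitions, or infinite and fair. A maximal transition sequence $(P_i,\lambda_i)$ is *lock-free* iff every top-level occurrence in any $P_i$ is executed by $P_j\xrightarrow{\lambda_j}P_{j+1}$ for some $j\ge i$. A process is lock-free iff all its maximal transition sequences are. *)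

theory Defs
  imports
    Complex_Main
    "HOL-Library.Finite_Map"
    "HOL-Library.Extended_Nat"
    "HOL-Library.Countable"
    "HOL-Library.Infinite_Typeclass"
begin

section \<open>Processes\<close>

datatype 'c pname = Pos 'c | Neg 'c

primrec dual :: "'c pname \<Rightarrow> 'c pname" where
  "dual (Pos c) = Neg c"
| "dual (Neg c) = Pos c"

datatype 'a val = VNat nat | VBool bool | VOther 'a

text \<open>Expressions are first-order terms over uninterpreted operation symbols; evaluation is an
  arbitrary total function \<open>eval\<close> passed to the transition relation. Data variables
  and process variables are de Bruijn indices, with separate numberings, so that terms are
  identified up to renaming of bound variables and substitution is capture-avoiding.\<close>

datatype ('o, 'a) expr =
    EVar nat
  | EVal "'a val"
  | EOp 'o "('o, 'a) expr list"

text \<open>\<open>Recv k P\<close> binds data variable 0 in \<open>P\<close>, \<open>Rec P\<close> binds process variable 0 in \<open>P\<close>, and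
  \<open>BRec e P Q\<close>, which stands for $(\mathrm{rec}^e X(i).P;Q)$, binds process variable 0 (as $X$)
  and data variable 0 (as $i$) in \<open>P\<close> only.\<close>

datatype ('c, 'l, 'o, 'a) proc =
    Send "'c pname" "('o, 'a) expr" "('c, 'l, 'o, 'a) proc"
  | Recv "'c pname" "('c, 'l, 'o, 'a) proc"
  | Select "'c pname" 'l "('c, 'l, 'o, 'a) proc"
  | Branch "'c pname" "('l, ('c, 'l, 'o, 'a) proc) fmap"
  | Inact
  | Par "('c, 'l, 'o, 'a) proc" "('c, 'l, 'o, 'a) proc"
  | Rec "('c, 'l, 'o, 'a) proc"
  | BRec "('o, 'a) expr" "('c, 'l, 'o, 'a) proc" "('c, 'l, 'o, 'a) proc"
  | PVar nat "'c pname fset"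
  | Cond "('o, 'a) expr" "('c, 'l, 'o, 'a) proc" "('c, 'l, 'o, 'a) proc"

primrec fn :: "('c, 'l, 'o, 'a) proc \<Rightarrow> 'c pname set" where
  "fn (Send k e P) = insert k (fn P)"
| "fn (Recv k P) = insert k (fn P)"
| "fn (Select k l P) = insert k (fn P)"
| "fn (Branch k B) = insert k (\<Union> (fmran' (fmmap fn B)))"
| "fn Inact = {}"
| "fn (Par P Q) = fn P \<union> fn Q"
| "fn (Rec P) = fn P"
| "fn (BRec e P Q) = fn P \<union> fn Q"
| "fn (PVar n ks) = fset ks"
| "fn (Cond e P Q) = fn P \<union> fn Q"

text \<open>\<open>elift n\<close>, \<open>dlift n\<close> and \<open>plift n\<close> increment the (data, data, process) variables from \<open>n\<close> on.\<close>

primrec elift :: "nat \<Rightarrow> ('o, 'a) expr \<Rightarrow> ('o, 'a) expr" where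
  "elift n (EVar m) = EVar (if m < n then m else Suc m)"
| "elift n (EVal v) = EVal v"
| "elift n (EOp f es) = EOp f (map (elift n) es)"

primrec dlift :: "('c, 'l, 'o, 'a) proc \<Rightarrow> nat \<Rightarrow> ('c, 'l, 'o, 'a) proc" where
  "dlift (Send k e P) = (\<lambda>n. Send k (elift n e) (dlift P n))"
| "dlift (Recv k P) = (\<lambda>n. Recv k (dlift P (Suc n)))"
| "dlift (Select k l P) = (\<lambda>n. Select k l (dlift P n))"
| "dlift (Branch k B) = (\<lambda>n. Branch k (fmmap (\<lambda>f. f n) (fmmap dlift B)))"
| "dlift Inact = (\<lambda>n. Inact)"
| "dlift (Par P Q) = (\<lambda>n. Par (dlift P n) (dlift Q n))"
| "dlift (Rec P) = (\<lambda>n. Rec (dlift P n))"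
| "dlift (BRec e P Q) = (\<lambda>n. BRec (elift n e) (dlift P (Suc n)) (dlift Q n))"
| "dlift (PVar m ks) = (\<lambda>n. PVar m ks)"
| "dlift (Cond e P Q) = (\<lambda>n. Cond (elift n e) (dlift P n) (dlift Q n))"

primrec plift :: "('c, 'l, 'o, 'a) proc \<Rightarrow> nat \<Rightarrow> ('c, 'l, 'o, 'a) proc" where
  "plift (Send k e P) = (\<lambda>n. Send k e (plift P n))"
| "plift (Recv k P) = (\<lambda>n. Recv k (plift P n))"
| "plift (Select k l P) = (\<lambda>n. Select k l (plift P n))"
| "plift (Branch k B) = (\<lambda>n. Branch k (fmmap (\<lambda>f. f n) (fmmap plift B)))"
| "plift Inact = (\<lambda>n. Inact)"
| "plift (Par P Q) = (\<lambda>n. Par (plift P n) (plift Q n))"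
| "plift (Rec P) = (\<lambda>n. Rec (plift P (Suc n)))"
| "plift (BRec e P Q) = (\<lambda>n. BRec e (plift P (Suc n)) (plift Q n))"
| "plift (PVar m ks) = (\<lambda>n. PVar (if m < n then m else Suc m) ks)"
| "plift (Cond e P Q) = (\<lambda>n. Cond e (plift P n) (plift Q n))"

text \<open>Substitution of the value \<open>v\<close> for data variable \<open>n\<close>, whose binder disappears.\<close>

primrec esub :: "nat \<Rightarrow> 'a val \<Rightarrow> ('o, 'a) expr \<Rightarrow> ('o, 'a) expr" where
  "esub n v (EVar m) = (if m < n then EVar m else if m = n then EVal v else EVar (m - 1))"
| "esub n v (EVal w) = EVal w"
| "esub n v (EOp f es) = EOp f (map (esub n v) es)"

primrec dsub :: "('c, 'l, 'o, 'a) proc \<Rightarrow> nat \<Rightarrow> 'a val \<Rightarrow> ('c, 'l, 'o, 'a) proc" where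
  "dsub (Send k e P) = (\<lambda>n v. Send k (esub n v e) (dsub P n v))"
| "dsub (Recv k P) = (\<lambda>n v. Recv k (dsub P (Suc n) v))"
| "dsub (Select k l P) = (\<lambda>n v. Select k l (dsub P n v))"
| "dsub (Branch k B) = (\<lambda>n v. Branch k (fmmap (\<lambda>f. f n v) (fmmap dsub B)))"
| "dsub Inact = (\<lambda>n v. Inact)"
| "dsub (Par P Q) = (\<lambda>n v. Par (dsub P n v) (dsub Q n v))"
| "dsub (Rec P) = (\<lambda>n v. Rec (dsub P n v))"
| "dsub (BRec e P Q) = (\<lambda>n v. BRec (esub n v e) (dsub P (Suc n) v) (dsub Q n v))"
| "dsub (PVar m ks) = (\<lambda>n v. PVar m ks)"
| "dsub (Cond e P Q) = (\<lambda>n v. Cond (esub n v e) (dsub P n v) (dsub Q n v))"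

text \<open>Substitution of the process \<open>R\<close> for process variable \<open>n\<close>; the names at the variable are
  dropped, as in $X[\tilde k]\{R/X\} = R$.\<close>

primrec psub :: "('c, 'l, 'o, 'a) proc \<Rightarrow> nat \<Rightarrow> ('c, 'l, 'o, 'a) proc \<Rightarrow> ('c, 'l, 'o, 'a) proc" where
  "psub (Send k e P) = (\<lambda>n R. Send k e (psub P n R))"
| "psub (Recv k P) = (\<lambda>n R. Recv k (psub P n (dlift R 0)))"
| "psub (Select k l P) = (\<lambda>n R. Select k l (psub P n R))"
| "psub (Branch k B) = (\<lambda>n R. Branch k (fmmap (\<lambda>f. f n R) (fmmap psub B)))"
| "psub Inact = (\<lambda>n R. Inact)"
| "psub (Par P Q) = (\<lambda>n R. Par (psub P n R) (psub Q n R))"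
| "psub (Rec P) = (\<lambda>n R. Rec (psub P (Suc n) (plift R 0)))"
| "psub (BRec e P Q) =
     (\<lambda>n R. BRec e (psub P (Suc n) (plift (dlift R 0) 0)) (psub Q n R))"
| "psub (PVar m ks) =
     (\<lambda>n R. if m < n then PVar m ks else if m = n then R else PVar (m - 1) ks)"
| "psub (Cond e P Q) = (\<lambda>n R. Cond e (psub P n R) (psub Q n R))"

definition unfold_rec :: "('c, 'l, 'o, 'a) proc \<Rightarrow> ('c, 'l, 'o, 'a) proc" where
  "unfold_rec P = psub P 0 (Rec P)"

definition unfold_brec ::
    "nat \<Rightarrow> ('c, 'l, 'o, 'a) proc \<Rightarrow> ('c, 'l, 'o, 'a) proc \<Rightarrow> ('c, 'l, 'o, 'a) proc" where
  "unfold_brec n P Q = psub (dsub P 0 (VNat n)) 0 (BRec (EVal (VNat n)) P Q)"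

text \<open>The convention on bodies of bounded recursion: no \<open>Inact\<close>, \<open>Par\<close>, \<open>Rec\<close> or \<open>BRec\<close>, and no
  process variable besides the bound one, which has index 0 everywhere in the body since there is
  no inner process variable binder.\<close>

inductive brec_body :: "('c, 'l, 'o, 'a) proc \<Rightarrow> bool" where
  "brec_body P \<Longrightarrow> brec_body (Send k e P)"
| "brec_body P \<Longrightarrow> brec_body (Recv k P)"
| "brec_body P \<Longrightarrow> brec_body (Select k l P)"
| "(\<And>l P. fmlookup B l = Some P \<Longrightarrow> brec_body P) \<Longrightarrow> brec_body (Branch k B)"
| "brec_body (PVar 0 ks)"
| "brec_body P \<Longrightarrow> brec_body Q \<Longrightarrow> brec_body (Cond e P Q)"

inductive wf_proc :: "('c, 'l, 'o, 'a) proc \<Rightarrow> bool" where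
  "wf_proc P \<Longrightarrow> wf_proc (Send k e P)"
| "wf_proc P \<Longrightarrow> wf_proc (Recv k P)"
| "wf_proc P \<Longrightarrow> wf_proc (Select k l P)"
| "B \<noteq> fmempty \<Longrightarrow> (\<And>l P. fmlookup B l = Some P \<Longrightarrow> wf_proc P) \<Longrightarrow> wf_proc (Branch k B)"
| "wf_proc Inact"
| "wf_proc P \<Longrightarrow> wf_proc Q \<Longrightarrow> wf_proc (Par P Q)"
| "wf_proc P \<Longrightarrow> wf_proc (Rec P)"
| "brec_body P \<Longrightarrow> wf_proc P \<Longrightarrow> wf_proc Q \<Longrightarrow> wf_proc (BRec e P Q)"
| "wf_proc (PVar n ks)"
| "wf_proc P \<Longrightarrow> wf_proc Q \<Longrightarrow> wf_proc (Cond e P Q)"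


section \<open>Process transitions\<close>

datatype ('c, 'l, 'a) plabel =
    POut "'c pname" "'a val"
  | PIn "'c pname" "'a val"
  | PSel "'c pname" 'l
  | PBra "'c pname" 'l
  | PTau
  | PTauL 'l

primrec subj :: "('c, 'l, 'a) plabel \<Rightarrow> 'c pname option" where
  "subj (POut k v) = Some k"
| "subj (PIn k v) = Some k"
| "subj (PSel k l) = Some k"
| "subj (PBra k l) = Some k"
| "subj PTau = None"
| "subj (PTauL l) = None"

datatype dir = GoL | GoR

type_synonym addr = "dir list"

text \<open>Transitions are considered together with their derivations, of which we record the set of
  addresses of the executed occurrences: \<open>step eval P l W P'\<close> says that there is a derivation of
  $P \xrightarrow{l} P'$ that executes exactly the addresses in \<open>W\<close>.\<close>

inductive step ::
    "(('o, 'a) expr \<Rightarrow> 'a val) \<Rightarrow> ('c, 'l, 'o, 'a) proc \<Rightarrow> ('c, 'l, 'a) plabel \<Rightarrow> addr set \<Rightarrow>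
     ('c, 'l, 'o, 'a) proc \<Rightarrow> bool"
  for eval :: "('o, 'a) expr \<Rightarrow> 'a val" where
  send: "eval e = v \<Longrightarrow> dual k \<notin> fn P \<Longrightarrow> step eval (Send k e P) (POut k v) {[]} P"
| recv: "dual k \<notin> fn P \<Longrightarrow> step eval (Recv k P) (PIn k v) {[]} (dsub P 0 v)"
| select: "dual k \<notin> fn P \<Longrightarrow> step eval (Select k l P) (PSel k l) {[]} P"
| branch: "fmlookup B l = Some P \<Longrightarrow> dual k \<notin> fn P \<Longrightarrow>
    step eval (Branch k B) (PBra k l) {[]} P"
| par_left: "step eval P a W Q \<Longrightarrow> \<forall>k. subj a = Some k \<longrightarrow> dual k \<notin> fn P' \<Longrightarrow>
    step eval (Par P P') a ((#) GoL ` W) (Par Q P')"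
| par_right: "step eval P a W Q \<Longrightarrow> \<forall>k. subj a = Some k \<longrightarrow> dual k \<notin> fn P' \<Longrightarrow>
    step eval (Par P' P) a ((#) GoR ` W) (Par P' Q)"
| com_left: "step eval P (POut (dual k) v) W P' \<Longrightarrow> step eval Q (PIn k v) V Q' \<Longrightarrow>
    step eval (Par P Q) PTau ((#) GoL ` W \<union> (#) GoR ` V) (Par P' Q')"
| com_right: "step eval P (PIn k v) W P' \<Longrightarrow> step eval Q (POut (dual k) v) V Q' \<Longrightarrow>
    step eval (Par P Q) PTau ((#) GoL ` W \<union> (#) GoR ` V) (Par P' Q')"
| sel_left: "step eval P (PSel (dual k) l) W P' \<Longrightarrow> step eval Q (PBra k l) V Q' \<Longrightarrow>
    step eval (Par P Q) (PTauL l) ((#) GoL ` W \<union> (#) GoR ` V) (Par P' Q')"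
| sel_right: "step eval P (PBra k l) W P' \<Longrightarrow> step eval Q (PSel (dual k) l) V Q' \<Longrightarrow>
    step eval (Par P Q) (PTauL l) ((#) GoL ` W \<union> (#) GoR ` V) (Par P' Q')"
| rec: "step eval (unfold_rec P) a W Q \<Longrightarrow> step eval (Rec P) a W Q"
| brec_zero: "eval e = VNat 0 \<Longrightarrow> step eval Q a W Q' \<Longrightarrow> step eval (BRec e P Q) a W Q'"
| brec_Suc: "eval e = VNat (Suc n) \<Longrightarrow> step eval (unfold_brec n P Q) a W P' \<Longrightarrow>
    step eval (BRec e P Q) a W P'"
| cond_true: "eval e = VBool True \<Longrightarrow> step eval P a W P' \<Longrightarrow> step eval (Cond e P Q) a W P'"
| cond_false: "eval e = VBool False \<Longrightarrow> step eval Q a W Q' \<Longrightarrow> step eval (Cond e P Q) a W Q'"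

definition ptrans ::
    "(('o, 'a) expr \<Rightarrow> 'a val) \<Rightarrow> ('c, 'l, 'o, 'a) proc \<Rightarrow> ('c, 'l, 'a) plabel \<Rightarrow>
     ('c, 'l, 'o, 'a) proc \<Rightarrow> bool" where
  "ptrans eval P a Q \<longleftrightarrow> (\<exists>W. step eval P a W Q)"

text \<open>The convention that conditions evaluate to booleans and bounds to naturals is only imposed on
  the conditions and bounds that actually get evaluated: those in front of the top-level actions of
  the processes reachable from \<open>P\<close>. (Quantifying instead over all value instances of all conditions
  in \<open>P\<close> would exclude every process that tests a received value.) The first predicate is
  coinductive because unguarded recursion such as $\mathrm{rec}\,X.X$ has infinitely many
  unfoldings.\<close>

coinductive top_sorted ::
    "(('o, 'a) expr \<Rightarrow> 'a val) \<Rightarrow> ('c, 'l, 'o, 'a) proc \<Rightarrow> bool"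
  for eval :: "('o, 'a) expr \<Rightarrow> 'a val" where
  "top_sorted eval (Send k e P)"
| "top_sorted eval (Recv k P)"
| "top_sorted eval (Select k l P)"
| "top_sorted eval (Branch k B)"
| "top_sorted eval Inact"
| "top_sorted eval P \<Longrightarrow> top_sorted eval Q \<Longrightarrow> top_sorted eval (Par P Q)"
| "top_sorted eval (unfold_rec P) \<Longrightarrow> top_sorted eval (Rec P)"
| "eval e = VNat 0 \<Longrightarrow> top_sorted eval Q \<Longrightarrow> top_sorted eval (BRec e P Q)"
| "eval e = VNat (Suc n) \<Longrightarrow> top_sorted eval (unfold_brec n P Q) \<Longrightarrow> top_sorted eval (BRec e P Q)"
| "top_sorted eval (PVar n ks)"
| "eval e = VBool True \<Longrightarrow> top_sorted eval P \<Longrightarrow> top_sorted eval (Cond e P Q)"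
| "eval e = VBool False \<Longrightarrow> top_sorted eval Q \<Longrightarrow> top_sorted eval (Cond e P Q)"

definition well_sorted ::
    "(('o, 'a) expr \<Rightarrow> 'a val) \<Rightarrow> ('c, 'l, 'o, 'a) proc \<Rightarrow> bool" where
  "well_sorted eval P \<longleftrightarrow> (\<forall>Q. (\<lambda>P Q. \<exists>a. ptrans eval P a Q)\<^sup>*\<^sup>* P Q \<longrightarrow> top_sorted eval Q)"


section \<open>Occurrences, maximality, lock-freedom\<close>

text \<open>\<open>occ eval P w\<close>: there is a top-level occurrence of an action at address \<open>w\<close> of \<open>P\<close>.\<close>

inductive occ ::
    "(('o, 'a) expr \<Rightarrow> 'a val) \<Rightarrow> ('c, 'l, 'o, 'a) proc \<Rightarrow> addr \<Rightarrow> bool"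
  for eval :: "('o, 'a) expr \<Rightarrow> 'a val" where
  "occ eval (Send k e P) []"
| "occ eval (Recv k P) []"
| "occ eval (Select k l P) []"
| "occ eval (Branch k B) []"
| "occ eval P w \<Longrightarrow> occ eval (Par P Q) (GoL # w)"
| "occ eval Q w \<Longrightarrow> occ eval (Par P Q) (GoR # w)"
| "occ eval (unfold_rec P) w \<Longrightarrow> occ eval (Rec P) w"
| "eval e = VNat 0 \<Longrightarrow> occ eval Q w \<Longrightarrow> occ eval (BRec e P Q) w"
| "eval e = VNat (Suc n) \<Longrightarrow> occ eval (unfold_brec n P Q) w \<Longrightarrow> occ eval (BRec e P Q) w"
| "eval e = VBool True \<Longrightarrow> occ eval P w \<Longrightarrow> occ eval (Cond e P Q) w"
| "eval e = VBool False \<Longrightarrow> occ eval Q w \<Longrightarrow> occ eval (Cond e P Q) w"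

definition enabled ::
    "(('o, 'a) expr \<Rightarrow> 'a val) \<Rightarrow> ('c, 'l, 'o, 'a) proc \<Rightarrow> addr \<Rightarrow> bool" where
  "enabled eval P w \<longleftrightarrow> occ eval P w \<and> (\<exists>a W Q. step eval P a W Q \<and> w \<in> W)"

text \<open>A sequence with \<open>N\<close> transitions (\<open>N = \<infinity>\<close> if it is infinite) has states \<open>Ps i\<close> for \<open>i \<le> N\<close> and
  transitions from \<open>Ps i\<close> to \<open>Ps (Suc i)\<close>, with label \<open>as i\<close> and executed addresses \<open>Ws i\<close>, for
  \<open>i < N\<close>; the values of these functions at other indices are irrelevant.\<close>

definition trans_seq ::
    "(('o, 'a) expr \<Rightarrow> 'a val) \<Rightarrow> ('c, 'l, 'o, 'a) proc \<Rightarrow> enat \<Rightarrow>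
     (nat \<Rightarrow> ('c, 'l, 'o, 'a) proc) \<Rightarrow> (nat \<Rightarrow> ('c, 'l, 'a) plabel) \<Rightarrow> (nat \<Rightarrow> addr set) \<Rightarrow> bool" where
  "trans_seq eval P N Ps as Ws \<longleftrightarrow>
     Ps 0 = P \<and> (\<forall>i. enat i < N \<longrightarrow> step eval (Ps i) (as i) (Ws i) (Ps (Suc i)))"

text \<open>An occurrence not executed by a transition is preserved at the same address. Hence an
  occurrence at address \<open>w\<close> of \<open>Ps i\<close> is executed at some point from \<open>i\<close> on iff \<open>w\<close> belongs to some
  \<open>Ws j\<close> with \<open>j \<ge> i\<close>: the first such \<open>j\<close> executes this very occurrence.\<close>

definition fair ::
    "(('o, 'a) expr \<Rightarrow> 'a val) \<Rightarrow> (nat \<Rightarrow> ('c, 'l, 'o, 'a) proc) \<Rightarrow> (nat \<Rightarrow> addr set) \<Rightarrow> bool" where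
  "fair eval Ps Ws \<longleftrightarrow> (\<forall>n w. enabled eval (Ps n) w \<longrightarrow> (\<exists>m\<ge>n. w \<in> Ws m))"

definition maximal ::
    "(('o, 'a) expr \<Rightarrow> 'a val) \<Rightarrow> enat \<Rightarrow>
     (nat \<Rightarrow> ('c, 'l, 'o, 'a) proc) \<Rightarrow> (nat \<Rightarrow> addr set) \<Rightarrow> bool" where
  "maximal eval N Ps Ws \<longleftrightarrow>
     (case N of enat n \<Rightarrow> \<not> (\<exists>a Q. ptrans eval (Ps n) a Q) | \<infinity> \<Rightarrow> fair eval Ps Ws)"

definition lock_free_seq ::
    "(('o, 'a) expr \<Rightarrow> 'a val) \<Rightarrow> enat \<Rightarrow>
     (nat \<Rightarrow> ('c, 'l, 'o, 'a) proc) \<Rightarrow> (nat \<Rightarrow> addr set) \<Rightarrow> bool" where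
  "lock_free_seq eval N Ps Ws \<longleftrightarrow>
     (\<forall>i w. enat i \<le> N \<longrightarrow> occ eval (Ps i) w \<longrightarrow> (\<exists>j\<ge>i. enat j < N \<and> w \<in> Ws j))"

definition lock_free ::
    "(('o, 'a) expr \<Rightarrow> 'a val) \<Rightarrow> ('c, 'l, 'o, 'a) proc \<Rightarrow> bool" where
  "lock_free eval P \<longleftrightarrow>
     (\<forall>N Ps as Ws. trans_seq eval P N Ps as Ws \<longrightarrow> maximal eval N Ps Ws \<longrightarrow>
        lock_free_seq eval N Ps Ws)"


section \<open>Session types\<close>

text \<open>Type expressions, with de Bruijn indices for the variables bound by $\mu$.\<close>

datatype 'l ty_expr =
    XBra "('l, 'l set \<times> 'l ty_expr) fmap"
  | XSel "('l, 'l set \<times> 'l ty_expr) fmap"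
  | XOut "'l ty_expr"
  | XIn "'l ty_expr"
  | XMu "'l ty_expr"
  | XVar nat
  | XEnd

text \<open>Possibly infinite type trees. The types of the calculus are the unfoldings of closed
  contractive type expressions, as singled out by \<open>is_type\<close> below.\<close>

codatatype 'l ty =
    TBra "('l, 'l set \<times> 'l ty) fmap"
  | TSel "('l, 'l set \<times> 'l ty) fmap"
  | TOut "'l ty"
  | TIn "'l ty"
  | TEnd

text \<open>\<open>xsub T n S\<close> substitutes the closed expression \<open>S\<close> for variable \<open>n\<close> in \<open>T\<close>; as \<open>S\<close> is closed,
  it is not shifted under binders.\<close>

primrec xsub :: "'l ty_expr \<Rightarrow> nat \<Rightarrow> 'l ty_expr \<Rightarrow> 'l ty_expr" where
  "xsub (XBra B) = (\<lambda>n S. XBra (fmmap (\<lambda>(M, f). (M, f n S)) (fmmap (map_prod id xsub) B)))"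
| "xsub (XSel B) = (\<lambda>n S. XSel (fmmap (\<lambda>(M, f). (M, f n S)) (fmmap (map_prod id xsub) B)))"
| "xsub (XOut T) = (\<lambda>n S. XOut (xsub T n S))"
| "xsub (XIn T) = (\<lambda>n S. XIn (xsub T n S))"
| "xsub (XMu T) = (\<lambda>n S. XMu (xsub T (Suc n) S))"
| "xsub (XVar m) = (\<lambda>n S. if m < n then XVar m else if m = n then S else XVar (m - 1))"
| "xsub XEnd = (\<lambda>n S. XEnd)"

primrec guarded :: "'l ty_expr \<Rightarrow> nat \<Rightarrow> bool" where
  "guarded (XBra B) = (\<lambda>n. True)"
| "guarded (XSel B) = (\<lambda>n. True)"
| "guarded (XOut T) = (\<lambda>n. True)"
| "guarded (XIn T) = (\<lambda>n. True)"
| "guarded (XMu T) = (\<lambda>n. guarded T (Suc n))"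
| "guarded (XVar m) = (\<lambda>n. m \<noteq> n)"
| "guarded XEnd = (\<lambda>n. True)"

text \<open>\<open>wf_ty n T\<close>: \<open>T\<close> is contractive, has free variables below \<open>n\<close>, and all its index sets are
  non-empty.\<close>

inductive wf_ty :: "nat \<Rightarrow> 'l ty_expr \<Rightarrow> bool" where
  "B \<noteq> fmempty \<Longrightarrow> (\<And>l M T. fmlookup B l = Some (M, T) \<Longrightarrow> wf_ty n T) \<Longrightarrow> wf_ty n (XBra B)"
| "B \<noteq> fmempty \<Longrightarrow> (\<And>l M T. fmlookup B l = Some (M, T) \<Longrightarrow> wf_ty n T) \<Longrightarrow> wf_ty n (XSel B)"
| "wf_ty n T \<Longrightarrow> wf_ty n (XOut T)"
| "wf_ty n T \<Longrightarrow> wf_ty n (XIn T)"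
| "guarded T 0 \<Longrightarrow> wf_ty (Suc n) T \<Longrightarrow> wf_ty n (XMu T)"
| "m < n \<Longrightarrow> wf_ty n (XVar m)"
| "wf_ty n XEnd"

text \<open>For closed contractive \<open>T\<close>, the unique \<open>U\<close> with \<open>unfolds_to T U\<close> is the infinite unfolding
  of \<open>T\<close>.\<close>

coinductive unfolds_to :: "'l ty_expr \<Rightarrow> 'l ty \<Rightarrow> bool" where
  "fmrel (rel_prod (=) unfolds_to) B C \<Longrightarrow> unfolds_to (XBra B) (TBra C)"
| "fmrel (rel_prod (=) unfolds_to) B C \<Longrightarrow> unfolds_to (XSel B) (TSel C)"
| "unfolds_to T U \<Longrightarrow> unfolds_to (XOut T) (TOut U)"
| "unfolds_to T U \<Longrightarrow> unfolds_to (XIn T) (TIn U)"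
| "unfolds_to (xsub T 0 (XMu T)) U \<Longrightarrow> unfolds_to (XMu T) U"
| "unfolds_to XEnd TEnd"
monos fmap.rel_mono prod.rel_mono

definition is_type :: "'l ty \<Rightarrow> bool" where
  "is_type U \<longleftrightarrow> (\<exists>T. wf_ty 0 T \<and> unfolds_to T U)"

datatype 'l tlabel = ROut | RIn | RBra 'l "'l set" | RSel 'l "'l set"

inductive ty_step :: "'l ty \<Rightarrow> 'l tlabel \<Rightarrow> 'l ty \<Rightarrow> bool" where
  "ty_step (TOut T) ROut T"
| "ty_step (TIn T) RIn T"
| "fmlookup B l = Some (M, T) \<Longrightarrow> ty_step (TBra B) (RBra l M) T"
| "fmlookup B l = Some (M, T) \<Longrightarrow> ty_step (TSel B) (RSel l M) T"


section \<open>Session environments\<close>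

type_synonym ('c, 'l) senv = "('c pname, 'l ty) fmap"

definition disj :: "('c, 'l) senv \<Rightarrow> ('c, 'l) senv \<Rightarrow> bool" where
  "disj D D' \<longleftrightarrow> fmdom' D \<inter> fmdom' D' = {}"

definition completed :: "('c, 'l) senv \<Rightarrow> bool" where
  "completed D \<longleftrightarrow> (\<forall>k T. fmlookup D k = Some T \<longrightarrow> T = TEnd)"

datatype ('c, 'l) elabel = DTau | DTauL 'l "'l set" | DAct "'c pname" "'l tlabel"

inductive env_step :: "('c, 'l) senv \<Rightarrow> ('c, 'l) elabel \<Rightarrow> ('c, 'l) senv \<Rightarrow> bool" where
  "ty_step T r T' \<Longrightarrow> env_step (fmupd k T fmempty) (DAct k r) (fmupd k T' fmempty)"
| "env_step D d D' \<Longrightarrow> disj D D'' \<Longrightarrow> disj D' D'' \<Longrightarrow> env_step (D ++\<^sub>f D'') d (D' ++\<^sub>f D'')"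
| "env_step D1 (DAct k ROut) D1' \<Longrightarrow> env_step D2 (DAct (dual k) RIn) D2' \<Longrightarrow>
    disj D1 D2 \<Longrightarrow> disj D1' D2' \<Longrightarrow> env_step (D1 ++\<^sub>f D2) DTau (D1' ++\<^sub>f D2')"
| "env_step D1 (DAct k (RSel l M)) D1' \<Longrightarrow> env_step D2 (DAct (dual k) (RBra l M')) D2' \<Longrightarrow>
    disj D1 D2 \<Longrightarrow> disj D1' D2' \<Longrightarrow> env_step (D1 ++\<^sub>f D2) (DTauL l (M \<union> M')) (D1' ++\<^sub>f D2')"

fun req :: "('c, 'l) elabel \<Rightarrow> 'l set" where
  "req (DAct k (RBra l M)) = M"
| "req (DAct k (RSel l M)) = M"
| "req (DTauL l M) = M"
| "req _ = {}"

fun res :: "('c, 'l) elabel \<Rightarrow> 'l set" where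
  "res (DAct k (RBra l M)) = {l}"
| "res (DAct k (RSel l M)) = {l}"
| "res (DTauL l M) = {l}"
| "res _ = {}"

definition env_seq ::
    "('c, 'l) senv \<Rightarrow> enat \<Rightarrow> (nat \<Rightarrow> ('c, 'l) senv) \<Rightarrow> (nat \<Rightarrow> ('c, 'l) elabel) \<Rightarrow> bool" where
  "env_seq D N Ds ds \<longleftrightarrow>
     Ds 0 = D \<and> (\<forall>i. enat i < N \<longrightarrow> env_step (Ds i) (ds i) (Ds (Suc i)))"

definition live :: "enat \<Rightarrow> (nat \<Rightarrow> ('c, 'l) elabel) \<Rightarrow> bool" where
  "live N ds \<longleftrightarrow>
     (\<forall>n. enat n < N \<longrightarrow> req (ds n) \<subseteq> (\<Union>m\<in>{m. n < m \<and> enat m < N}. res (ds m)))"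

inductive corr :: "('c, 'l) elabel \<Rightarrow> ('c, 'l, 'a) plabel \<Rightarrow> bool" where
  "corr DTau PTau"
| "corr (DTauL l M) (PTauL l)"
| "corr (DAct k (RBra l M)) (PBra k l)"
| "corr (DAct k (RSel l M)) (PSel k l)"
| "corr (DAct k ROut) (POut k v)"
| "corr (DAct k RIn) (PIn k v)"


section \<open>Typing\<close>

text \<open>Process variable environments are lists, the entry for variable \<open>n\<close> being at position \<open>n\<close>.\<close>

datatype ('c, 'l) pentry =
    GenE "'l set" "'l set" "('c, 'l) senv"
  | BndE "'l set" "('c, 'l) senv"

primrec add_label :: "'l \<Rightarrow> ('c, 'l) pentry \<Rightarrow> ('c, 'l) pentry" where
  "add_label l (GenE A I D) = GenE (insert l A) I D"
| "add_label l (BndE M D) = BndE M D"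

inductive live_typing ::
    "('c, 'l) pentry list \<Rightarrow> 'l set \<Rightarrow> ('c, 'l, 'o, 'a) proc \<Rightarrow> ('c, 'l) senv \<Rightarrow> bool" where
  "live_typing G M P (fmupd k T D) \<Longrightarrow> k |\<notin>| fmdom D \<Longrightarrow>
    live_typing G M (Send k e P) (fmupd k (TOut T) D)"
| "live_typing G M P (fmupd k T D) \<Longrightarrow> k |\<notin>| fmdom D \<Longrightarrow>
    live_typing G M (Recv k P) (fmupd k (TIn T) D)"
| "fmdom B = fmdom C \<Longrightarrow> k |\<notin>| fmdom D \<Longrightarrow>
    (\<And>l P K T. fmlookup B l = Some P \<Longrightarrow> fmlookup C l = Some (K, T) \<Longrightarrow>
       live_typing (map (add_label l) G) ((M - {l}) \<union> K) P (fmupd k T D)) \<Longrightarrow>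
    live_typing G M (Branch k B) (fmupd k (TBra C) D)"
| "fmlookup C l = Some (K, T) \<Longrightarrow> k |\<notin>| fmdom D \<Longrightarrow>
    live_typing (map (add_label l) G) ((M - {l}) \<union> K) P (fmupd k T D) \<Longrightarrow>
    live_typing G M (Select k l P) (fmupd k (TSel C) D)"
| "live_typing G M1 P1 D1 \<Longrightarrow> live_typing G M2 P2 D2 \<Longrightarrow> disj D1 D2 \<Longrightarrow>
    live_typing G (M1 \<union> M2) (Par P1 P2) (D1 ++\<^sub>f D2)"
| "completed D \<Longrightarrow> live_typing G {} Inact D"
| "n < length G \<Longrightarrow> G ! n = GenE A I D \<Longrightarrow> M \<subseteq> I \<Longrightarrow> I \<subseteq> A \<Longrightarrow> fmdom D = ks \<Longrightarrow>
    live_typing G M (PVar n ks) D"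
| "n < length G \<Longrightarrow> G ! n = BndE M' D \<Longrightarrow> M \<subseteq> M' \<Longrightarrow> fmdom D = ks \<Longrightarrow>
    live_typing G M (PVar n ks) D"
| "live_typing (BndE M' D # G) M' P D \<Longrightarrow> live_typing G M' Q D \<Longrightarrow> M \<subseteq> M' \<Longrightarrow>
    live_typing G M (BRec e P Q) D"
| "live_typing (GenE {} I D # G) I P D \<Longrightarrow> M \<subseteq> I \<Longrightarrow> live_typing G M (Rec P) D"
| "live_typing G M P D \<Longrightarrow> live_typing G M Q D \<Longrightarrow> live_typing G M (Cond e P Q) D"

inductive std_typing ::
    "('c, 'l) senv list \<Rightarrow> ('c, 'l, 'o, 'a) proc \<Rightarrow> ('c, 'l) senv \<Rightarrow> bool" where
  "std_typing G P (fmupd k T D) \<Longrightarrow> k |\<notin>| fmdom D \<Longrightarrow>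
    std_typing G (Send k e P) (fmupd k (TOut T) D)"
| "std_typing G P (fmupd k T D) \<Longrightarrow> k |\<notin>| fmdom D \<Longrightarrow>
    std_typing G (Recv k P) (fmupd k (TIn T) D)"
| "fmdom B = fmdom C \<Longrightarrow> k |\<notin>| fmdom D \<Longrightarrow>
    (\<And>l P K T. fmlookup B l = Some P \<Longrightarrow> fmlookup C l = Some (K, T) \<Longrightarrow>
       std_typing G P (fmupd k T D)) \<Longrightarrow>
    std_typing G (Branch k B) (fmupd k (TBra C) D)"
| "fmlookup C l = Some (K, T) \<Longrightarrow> k |\<notin>| fmdom D \<Longrightarrow> std_typing G P (fmupd k T D) \<Longrightarrow>
    std_typing G (Select k l P) (fmupd k (TSel C) D)"
| "std_typing G P1 D1 \<Longrightarrow> std_typing G P2 D2 \<Longrightarrow> disj D1 D2 \<Longrightarrow>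
    std_typing G (Par P1 P2) (D1 ++\<^sub>f D2)"
| "completed D \<Longrightarrow> std_typing G Inact D"
| "n < length G \<Longrightarrow> G ! n = D \<Longrightarrow> fmdom D = ks \<Longrightarrow> std_typing G (PVar n ks) D"
| "std_typing (D # G) P D \<Longrightarrow> std_typing G Q D \<Longrightarrow> std_typing G (BRec e P Q) D"
| "std_typing (D # G) P D \<Longrightarrow> std_typing G (Rec P) D"
| "std_typing G P D \<Longrightarrow> std_typing G Q D \<Longrightarrow> std_typing G (Cond e P Q) D"

definition typed_step ::
    "(('o, 'a) expr \<Rightarrow> 'a val) \<Rightarrow> ('c, 'l) senv list \<Rightarrow>
     ('c, 'l, 'o, 'a) proc \<Rightarrow> ('c, 'l) senv \<Rightarrow> ('c, 'l, 'a) plabel \<Rightarrow> ('c, 'l) elabel \<Rightarrow>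
     ('c, 'l, 'o, 'a) proc \<Rightarrow> ('c, 'l) senv \<Rightarrow> bool" where
  "typed_step eval G P D a d P' D' \<longleftrightarrow>
     std_typing G P D \<and> std_typing G P' D' \<and> ptrans eval P a P' \<and> env_step D d D' \<and> corr d a"

definition typed_seq ::
    "(('o, 'a) expr \<Rightarrow> 'a val) \<Rightarrow> ('c, 'l) senv list \<Rightarrow>
     ('c, 'l, 'o, 'a) proc \<Rightarrow> ('c, 'l) senv \<Rightarrow> enat \<Rightarrow>
     (nat \<Rightarrow> ('c, 'l, 'o, 'a) proc) \<Rightarrow> (nat \<Rightarrow> ('c, 'l) senv) \<Rightarrow>
     (nat \<Rightarrow> ('c, 'l, 'a) plabel) \<Rightarrow> (nat \<Rightarrow> ('c, 'l) elabel) \<Rightarrow> bool" where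
  "typed_seq eval G P D N Ps Ds as ds \<longleftrightarrow>
     Ps 0 = P \<and> Ds 0 = D \<and> std_typing G P D \<and>
     (\<forall>i. enat i < N \<longrightarrow>
        typed_step eval G (Ps i) (Ds i) (as i) (ds i) (Ps (Suc i)) (Ds (Suc i)))"

definition live_proc ::
    "(('o, 'a) expr \<Rightarrow> 'a val) \<Rightarrow> ('c, 'l) senv list \<Rightarrow> ('c, 'l) senv \<Rightarrow>
     ('c, 'l, 'o, 'a) proc \<Rightarrow> bool" where
  "live_proc eval G D P \<longleftrightarrow>
     (\<forall>N Ps as Ws. trans_seq eval P N Ps as Ws \<longrightarrow> maximal eval N Ps Ws \<longrightarrow>
        (\<exists>Ds ds. env_seq D N Ds ds \<and> live N ds \<and> typed_seq eval G P D N Ps Ds as ds))"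

end

theory Submission
  imports Defs
begin

text \<open>The label set of a typing judgement is a set of promises. A pending label \<open>l\<close> is \<^emph>\<open>inevitable\<close>
  in the sense of a well-founded game tree: whichever values and branches a thread receives, it
  cannot run forever without executing \<open>l\<close>. Indeed, while \<open>l\<close> is pending, a recursion variable can
  only be reached if \<open>l\<close> has been executed since its recursion was entered, so that each such return
  uses up one of the recursions entered before \<open>l\<close> became pending; and bounded recursions
  decrease their counter. Lock-freedom makes every thread of a maximal sequence run until it
  terminates, so inevitable labels do occur. By subject reduction, the labels requested by a
  transition are pending in its target.\<close>

section \<open>Substitution\<close>

lemma elift_elift: "m \<le> n \<Longrightarrow> elift m (elift n e) = elift (Suc n) (elift m e)"
  by (induction e) auto

lemma esub_elift: "esub n v (elift n e) = e"
  by (induction e) (auto simp: map_idI)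

lemma fmmap_idI: "(\<And>x. x \<in> fmran' B \<Longrightarrow> f x = x) \<Longrightarrow> fmmap f B = B"
  using fmap.map_cong0[of B f id] by (simp add: fmap.map_id)

lemma dlift_dlift: "m \<le> n \<Longrightarrow> dlift (dlift P n) m = dlift (dlift P m) (Suc n)"
  by (induction P arbitrary: m n) (auto simp: elift_elift fmap.map_comp intro!: fmap.map_cong0)

lemma plift_dlift: "plift (dlift P n) m = dlift (plift P m) n"
  by (induction P arbitrary: m n) (auto simp: fmap.map_comp intro!: fmap.map_cong0)

lemma dsub_dlift: "dsub (dlift P n) n v = P"
  by (induction P arbitrary: n) (auto simp: esub_elift fmap.map_comp intro!: fmmap_idI)

text \<open>Lifting \<open>R\<close> past data variable \<open>d\<close> cancels against the
  substitution for \<open>d\<close>. This carries a received value through a substitution of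
  processes.\<close>

lemma dsub_psub: "dsub (psub P n (dlift R d)) d v = psub (dsub P d v) n R"
proof (induction P arbitrary: n d R)
  case (Recv k P)
  then show ?case by (simp add: dlift_dlift)
next
  case (Branch k B)
  then show ?case by (auto simp: fmap.map_comp intro!: fmap.map_cong0)
next
  case (BRec e P Q)
  then show ?case by (simp add: dlift_dlift plift_dlift)
qed (auto simp: dsub_dlift plift_dlift)

text \<open>Records the values instantiated on the way into a term, so that an induction can stay on
  the typing of the original term. The list is applied from left to right, so new values are
  appended.\<close>

definition dsubs :: "(nat \<times> 'a val) list \<Rightarrow> ('c, 'l, 'o, 'a) proc \<Rightarrow> ('c, 'l, 'o, 'a) proc" where
  "dsubs xs P = fold (\<lambda>(n, v) P. dsub P n v) xs P"

definition esubs :: "(nat \<times> 'a val) list \<Rightarrow> ('o, 'a) expr \<Rightarrow> ('o, 'a) expr" where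
  "esubs xs e = fold (\<lambda>(n, v). esub n v) xs e"

abbreviation shift :: "(nat \<times> 'a val) list \<Rightarrow> (nat \<times> 'a val) list" where
  "shift xs \<equiv> map (apfst Suc) xs"

lemma dsubs_Nil [simp]: "dsubs [] P = P"
  and dsubs_snoc: "dsub (dsubs xs P) n v = dsubs (xs @ [(n, v)]) P"
  by (simp_all add: dsubs_def)

lemma dsubs_simps [simp]:
  "dsubs xs (Send k e P) = Send k (esubs xs e) (dsubs xs P)"
  "dsubs xs (Recv k P) = Recv k (dsubs (shift xs) P)"
  "dsubs xs (Select k l P) = Select k l (dsubs xs P)"
  "dsubs xs (Branch k B) = Branch k (fmmap (dsubs xs) B)"
  "dsubs xs Inact = Inact"
  "dsubs xs (Par P Q) = Par (dsubs xs P) (dsubs xs Q)"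
  "dsubs xs (Rec P) = Rec (dsubs xs P)"
  "dsubs xs (BRec e P Q) = BRec (esubs xs e) (dsubs (shift xs) P) (dsubs xs Q)"
  "dsubs xs (PVar m ks) = PVar m ks"
  "dsubs xs (Cond e P Q) = Cond (esubs xs e) (dsubs xs P) (dsubs xs Q)"
proof -
  show "dsubs xs (Branch k B) = Branch k (fmmap (dsubs xs) B)"
    unfolding dsubs_def
    by (induction xs arbitrary: B) (auto simp: fmap.map_comp comp_def fmmap_idI)
  show "dsubs xs (Send k e P) = Send k (esubs xs e) (dsubs xs P)"
    unfolding dsubs_def esubs_def by (induction xs arbitrary: e P) auto
  show "dsubs xs (Recv k P) = Recv k (dsubs (shift xs) P)"
    unfolding dsubs_def by (induction xs arbitrary: P) auto
  show "dsubs xs (Select k l P) = Select k l (dsubs xs P)"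
    unfolding dsubs_def by (induction xs arbitrary: P) auto
  show "dsubs xs Inact = Inact"
    unfolding dsubs_def by (induction xs) auto
  show "dsubs xs (Par P Q) = Par (dsubs xs P) (dsubs xs Q)"
    unfolding dsubs_def by (induction xs arbitrary: P Q) auto
  show "dsubs xs (Rec P) = Rec (dsubs xs P)"
    unfolding dsubs_def by (induction xs arbitrary: P) auto
  show "dsubs xs (BRec e P Q) = BRec (esubs xs e) (dsubs (shift xs) P) (dsubs xs Q)"
    unfolding dsubs_def esubs_def by (induction xs arbitrary: e P Q) auto
  show "dsubs xs (PVar m ks) = PVar m ks"
    unfolding dsubs_def by (induction xs) auto
  show "dsubs xs (Cond e P Q) = Cond (esubs xs e) (dsubs xs P) (dsubs xs Q)"
    unfolding dsubs_def esubs_def by (induction xs arbitrary: e P Q) auto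
qed

text \<open>The terms of \<open>\<sigma>\<close> are meant to be closed, so that the order of the substitutions does not
  matter; with the innermost variable replaced last, unfolding a closed recursion amounts to
  adding an entry to \<open>\<sigma>\<close>.\<close>

primrec closing ::
    "nat \<Rightarrow> ('c, 'l, 'o, 'a) proc list \<Rightarrow> ('c, 'l, 'o, 'a) proc \<Rightarrow> ('c, 'l, 'o, 'a) proc" where
  "closing n [] P = P"
| "closing n (R # \<sigma>) P = psub (closing (Suc n) \<sigma> P) n R"

text \<open>Invariance under lifting from every index expresses that no process variable is
  free.\<close>

definition pclosed :: "('c, 'l, 'o, 'a) proc \<Rightarrow> bool" where
  "pclosed R \<longleftrightarrow> (\<forall>n. plift R n = R)"

abbreviation dlifts :: "('c, 'l, 'o, 'a) proc list \<Rightarrow> ('c, 'l, 'o, 'a) proc list" where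
  "dlifts \<sigma> \<equiv> map (\<lambda>R. dlift R 0) \<sigma>"

lemma closing_simps:
  "closing n \<sigma> (Send k e P) = Send k e (closing n \<sigma> P)"
  "closing n \<sigma> (Recv k P) = Recv k (closing n (dlifts \<sigma>) P)"
  "closing n \<sigma> (Select k l P) = Select k l (closing n \<sigma> P)"
  "closing n \<sigma> (Branch k B) = Branch k (fmmap (closing n \<sigma>) B)"
  "closing n \<sigma> Inact = Inact"
  "closing n \<sigma> (Par P Q) = Par (closing n \<sigma> P) (closing n \<sigma> Q)"
  "closing n \<sigma> (Cond e P Q) = Cond e (closing n \<sigma> P) (closing n \<sigma> Q)"
  by (induction \<sigma> arbitrary: n)
    (auto simp: fmap.map_comp intro!: fmap.map_cong0 fmmap_idI[symmetric])

text \<open>Closedness cancels the \<open>plift\<close> that \<open>psub\<close> performs under a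
  process binder; the data binder of \<open>BRec\<close> still leaves a \<open>dlift\<close>, hence
  \<open>dlifts \<sigma>\<close>.\<close>

lemma closing_Rec:
  assumes "\<forall>R\<in>set \<sigma>. pclosed R"
  shows "closing n \<sigma> (Rec P) = Rec (closing (Suc n) \<sigma> P)"
    and "closing n \<sigma> (BRec e P Q) = BRec e (closing (Suc n) (dlifts \<sigma>) P) (closing n \<sigma> Q)"
  using assms by (induction \<sigma> arbitrary: n) (auto simp: pclosed_def plift_dlift)

lemma psub_plift: "psub (plift P n) n R = P"
  by (induction P arbitrary: n R) (auto simp: fmap.map_comp intro!: fmmap_idI)

lemma psub_pclosed: "pclosed P \<Longrightarrow> psub P n R = P"
  by (metis pclosed_def psub_plift)

text \<open>Once a term of \<open>\<sigma>\<close> has been put in, the remaining substitutions pass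
  over it because it is closed.\<close>

lemma closing_PVar:
  assumes "\<forall>R\<in>set \<sigma>. pclosed R" and "m < length \<sigma>"
  shows "closing n \<sigma> (PVar (n + m) ks) = \<sigma> ! m"
  using assms
proof (induction \<sigma> arbitrary: n m)
  case (Cons R \<sigma>)
  have free: "closing (Suc j) \<sigma>' (PVar i ks) = PVar i ks" if "i \<le> j"
    for i j and \<sigma>' :: "('a, 'b, 'c, 'd) proc list"
    using that by (induction \<sigma>' arbitrary: j) auto
  show ?case
  proof (cases m)
    case 0
    then show ?thesis by (simp add: free)
  next
    case (Suc m')
    then show ?thesis
      using Cons.IH[of m' "Suc n"] Cons.prems by (simp add: psub_pclosed)
  qed
qed simp

lemma dsub_closing: "dsub (closing n (dlifts \<sigma>) P) 0 v = closing n \<sigma> (dsub P 0 v)"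
  by (induction \<sigma> arbitrary: n) (auto simp: dsub_psub)

section \<open>Subject reduction\<close>

lemma live_typing_dlift: "live_typing G M P D \<Longrightarrow> live_typing G M (dlift P n) D"
proof (induction arbitrary: n rule: live_typing.induct)
  case (3 B C k D G M)
  then show ?case by (auto intro!: live_typing.intros(3))
qed (auto intro: live_typing.intros)

lemma live_typing_dsub: "live_typing G M P D \<Longrightarrow> live_typing G M (dsub P n v) D"
proof (induction arbitrary: n rule: live_typing.induct)
  case (3 B C k D G M)
  then show ?case by (auto intro!: live_typing.intros(3))
qed (auto intro: live_typing.intros)

lemma live_typing_dsubs: "live_typing G M P D \<Longrightarrow> live_typing G M (dsubs xs P) D"
  unfolding dsubs_def by (induction xs arbitrary: P) (auto intro: live_typing_dsub)

text \<open>The free process variables of a typed term lie below \<open>length G\<close>, out of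
  reach of a lifting from \<open>n\<close> on.\<close>

lemma live_typing_plift: "live_typing G M P D \<Longrightarrow> length G \<le> n \<Longrightarrow> plift P n = P"
proof (induction arbitrary: n rule: live_typing.induct)
  case (3 B C k D G M)
  have "plift P n = P" if P: "P \<in> fmran' B" for P
  proof -
    obtain l where l: "fmlookup B l = Some P" using P by (auto simp: fmran'_def ran_def)
    \<comment> \<open>\<open>B\<close> and \<open>C\<close> have the same labels, so each branch
      comes with a typing premise and hence an induction hypothesis.\<close>
    with 3(1) have "l |\<in>| fmdom C" by (metis fmdomI)
    then obtain K T where "fmlookup C l = Some (K, T)" by (metis fmdomE prod.exhaust)
    with l 3 show ?thesis by auto
  qed
  then show ?case by (auto simp: fmap.map_comp intro!: fmmap_idI)
qed auto

lemma live_typing_pclosed: "live_typing [] M P D \<Longrightarrow> pclosed P"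
  by (simp add: pclosed_def live_typing_plift)

text \<open>Entries added at the far end do not disturb existing indices. This moves closed terms
  into arbitrary environments.\<close>

lemma live_typing_weaken: "live_typing G M P D \<Longrightarrow> live_typing (G @ G') M P D"
proof (induction arbitrary: G' rule: live_typing.induct)
  case (3 B C k D G M)
  then show ?case by (auto intro!: live_typing.intros(3))
next
  case (7 n G A I D M ks)
  then show ?case by (auto intro!: live_typing.intros(7) simp: nth_append)
next
  case (8 n G M' D M ks)
  then show ?case by (auto intro!: live_typing.intros(8) simp: nth_append)
qed (auto intro: live_typing.intros)

text \<open>The variable rules admit every pending set below the bound, so \<open>R\<close> must be
  typable with all of them. The condition is the same for every \<open>A\<close>, which makes it
  stable under \<open>add_label\<close>.\<close>

fun entry_ok :: "('c, 'l) pentry \<Rightarrow> ('c, 'l, 'o, 'a) proc \<Rightarrow> bool" where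
  "entry_ok (GenE A I D) R \<longleftrightarrow> (\<forall>M\<subseteq>I. live_typing [] M R D)"
| "entry_ok (BndE M' D) R \<longleftrightarrow> (\<forall>M\<subseteq>M'. live_typing [] M R D)"

lemma entry_ok_pclosed: "entry_ok E R \<Longrightarrow> pclosed R"
  by (cases E) (auto intro: live_typing_pclosed)

lemma entry_ok_dlift: "entry_ok E R \<Longrightarrow> entry_ok E (dlift R n)"
  by (cases E) (auto intro: live_typing_dlift)

lemma entry_ok_add_label [simp]: "entry_ok (add_label l E) R \<longleftrightarrow> entry_ok E R"
  by (cases E) auto

text \<open>The replaced variable is the outermost one: passing a binder extends \<open>G\<close> at
  the front and leaves \<open>E\<close> last. \<open>E\<close> is generalised because label
  exchanges modify it.\<close>

lemma live_typing_psub: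
  "live_typing (G @ [E]) M P D \<Longrightarrow> entry_ok E R \<Longrightarrow> live_typing G M (psub P (length G) R) D"
proof (induction "G @ [E]" M P D arbitrary: G E R rule: live_typing.induct)
  case (2 M P k T D e)
  then show ?case by (auto intro: live_typing.intros entry_ok_dlift)
next
  case (3 B C k D M)
  then show ?case
    by (auto intro!: live_typing.intros(3) simp: 3(4)[where G = "map (add_label _) G" for G, simplified])
next
  case (4 C l K T k D M P)
  from 4(4)[of "map (add_label l) G" "add_label l E" R] 4 show ?case
    by (auto intro: live_typing.intros)
next
  case (7 n A I D M ks)
  show ?case
  proof (cases "n < length G")
    case True
    with 7 show ?thesis by (auto intro!: live_typing.intros(7) simp: nth_append)
  next
    case False
    with 7 have "n = length G" "E = GenE A I D" by (auto simp: nth_append)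
    with 7 show ?thesis using live_typing_weaken[of "[]" M R D G] by simp
  qed
next
  case (8 n M' D M ks)
  show ?case
  proof (cases "n < length G")
    case True
    with 8 show ?thesis by (auto intro!: live_typing.intros(8) simp: nth_append)
  next
    case False
    with 8 have "n = length G" "E = BndE M' D" by (auto simp: nth_append)
    with 8 show ?thesis using live_typing_weaken[of "[]" M R D G] by simp
  qed
next
  case (9 M' D P Q M e)
  from 9(2)[of "BndE M' D # G" E "dlift R 0"] 9 show ?case
    \<comment> \<open>\<open>dlift R 0\<close> is closed as well, so the \<open>plift\<close> under
      the binder is the identity.\<close>
    using entry_ok_dlift[of E R] entry_ok_pclosed[of E "dlift R 0"]
    by (auto intro!: live_typing.intros simp: pclosed_def)
next
  case (10 I D P M)
  from 10(2)[of "GenE {} I D # G" E R] 10 show ?case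
    using entry_ok_pclosed[of E R]
    by (auto intro!: live_typing.intros simp: pclosed_def)
qed (auto intro: live_typing.intros)

text \<open>\<open>closing\<close> inserts the head of the list last. The induction therefore first
  moves its entry to the end of \<open>G0\<close>, from where \<open>live_typing_psub\<close>
  removes it.\<close>

lemma live_typing_closing:
  assumes "list_all2 entry_ok G \<sigma>" and "live_typing (G0 @ G) M P D"
  shows "live_typing G0 M (closing (length G0) \<sigma> P) D"
  using assms
proof (induction G \<sigma> arbitrary: G0 rule: list_all2_induct)
  case (Cons E G R \<sigma>)
  with Cons.IH[of "G0 @ [E]"] show ?case by (auto intro: live_typing_psub)
qed simp

text \<open>\<open>Rec P\<close> itself is typable with every pending set below \<open>I\<close>, so
  it may replace the variable. The unfolding is typed with all of \<open>I\<close>, possibly more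
  than \<open>M\<close>.\<close>

lemma live_typing_unfold_rec:
  assumes "live_typing [] M (Rec P) D"
  obtains I where "M \<subseteq> I" "live_typing [] I (unfold_rec P) D"
proof -
  from assms obtain I where I: "live_typing [GenE {} I D] I P D" "M \<subseteq> I"
    by (cases rule: live_typing.cases) auto
  then have "live_typing [] I (psub P (length ([] :: ('a, 'b) pentry list)) (Rec P)) D"
    by (intro live_typing_psub[of "[]"]) (auto intro: live_typing.intros)
  with I that show thesis by (auto simp: unfold_rec_def)
qed

text \<open>The typing rule holds for any bound, so the copy with the literal counter is typed like
  the original.\<close>

lemma live_typing_unfold_brec:
  assumes "live_typing [] M (BRec e P Q) D"
  obtains M' where "M \<subseteq> M'" "live_typing [] M' (unfold_brec n P Q) D" "live_typing [] M' Q D"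
proof -
  from assms obtain M' where M': "live_typing [BndE M' D] M' P D" "live_typing [] M' Q D" "M \<subseteq> M'"
    by (cases rule: live_typing.cases) auto
  then have "live_typing [] M' (psub (dsub P 0 (VNat n)) (length ([] :: ('a, 'b) pentry list))
      (BRec (EVal (VNat n)) P Q)) D"
    by (intro live_typing_psub[of "[]"]) (auto intro: live_typing.intros live_typing_dsub)
  with M' that show thesis by (auto simp: unfold_brec_def)
qed

section \<open>Session environments and typing of reducts\<close>

lemma dual_dual [simp]: "dual (dual k) = k"
  by (cases k) auto

lemma disj_iff: "disj D D' \<longleftrightarrow> (\<forall>k. k |\<in>| fmdom D \<longrightarrow> k |\<notin>| fmdom D')"
  unfolding disj_def fmdom'_alt_def by blast

lemma fmadd_disj_commute:
  assumes "disj D D'"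
  shows "D ++\<^sub>f D' = D' ++\<^sub>f D"
proof (rule fmap_ext)
  fix k
  have "k |\<notin>| fmdom D \<or> k |\<notin>| fmdom D'"
    using assms by (auto simp: disj_iff)
  then show "fmlookup (D ++\<^sub>f D') k = fmlookup (D' ++\<^sub>f D) k"
    using fmdom_notD by fastforce
qed

text \<open>The basic rule moves a singleton environment; the framing rule adds
  \<open>D\<close>.\<close>

lemma env_step_fmupd:
  assumes "ty_step T r T'" and "k |\<notin>| fmdom D"
  shows "env_step (fmupd k T D) (DAct k r) (fmupd k T' D)"
proof -
  have eq: "fmupd k U fmempty ++\<^sub>f D = fmupd k U D" for U
    using assms(2) by (intro fmap_ext) auto
  have "disj (fmupd k U fmempty) D" for U
    using assms(2) by (simp add: disj_iff)
  with env_step.intros(2)[OF env_step.intros(1)[OF assms(1), of k], of D] show ?thesis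
    by (simp add: eq)
qed

lemma disj_cong: "fmdom D1 = fmdom D1' \<Longrightarrow> fmdom D2 = fmdom D2' \<Longrightarrow> disj D1 D2 = disj D1' D2'"
  by (simp add: disj_iff)

lemma disj_sym: "disj D D' \<longleftrightarrow> disj D' D"
  by (auto simp: disj_def)

lemma corr_iff:
  "corr d (POut k v) \<longleftrightarrow> d = DAct k ROut"
  "corr d (PIn k v) \<longleftrightarrow> d = DAct k RIn"
  "corr d (PSel k l) \<longleftrightarrow> (\<exists>K. d = DAct k (RSel l K))"
  "corr d (PBra k l) \<longleftrightarrow> (\<exists>K. d = DAct k (RBra l K))"
  by (simp_all add: corr.simps)

text \<open>The conclusion of subject reduction. Equal domains preserve disjointness in parallel
  compositions. \<open>M'\<close> only has to contain the labels requested by this step; their later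
  fate is the concern of \<open>inevitable\<close>.\<close>

definition reduct_typing ::
    "('c, 'l) senv \<Rightarrow> ('c, 'l, 'a) plabel \<Rightarrow> ('c, 'l, 'o, 'a) proc \<Rightarrow> bool" where
  "reduct_typing D a P' \<longleftrightarrow>
     (\<exists>d D' M'. env_step D d D' \<and> corr d a \<and> fmdom D' = fmdom D \<and> live_typing [] M' P' D' \<and> req d \<subseteq> M')"

lemma reduct_typingI:
  "env_step D d D' \<Longrightarrow> corr d a \<Longrightarrow> fmdom D' = fmdom D \<Longrightarrow> live_typing [] M' P' D' \<Longrightarrow> req d \<subseteq> M' \<Longrightarrow>
    reduct_typing D a P'"
  by (auto simp: reduct_typing_def)

lemma reduct_typing_out:
  assumes "reduct_typing D (POut k v) P'"
  obtains D' M' where "env_step D (DAct k ROut) D'" "fmdom D' = fmdom D" "live_typing [] M' P' D'"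
  using assms unfolding reduct_typing_def corr_iff by metis

lemma reduct_typing_in:
  assumes "reduct_typing D (PIn k v) P'"
  obtains D' M' where "env_step D (DAct k RIn) D'" "fmdom D' = fmdom D" "live_typing [] M' P' D'"
  using assms unfolding reduct_typing_def corr_iff by metis

lemma reduct_typing_select:
  assumes "reduct_typing D (PSel k l) P'"
  obtains K D' M' where "env_step D (DAct k (RSel l K)) D'" "fmdom D' = fmdom D"
    "live_typing [] M' P' D'" "K \<subseteq> M'"
  using assms unfolding reduct_typing_def corr_iff by (metis req.simps(2))

lemma reduct_typing_branch:
  assumes "reduct_typing D (PBra k l) P'"
  obtains K D' M' where "env_step D (DAct k (RBra l K)) D'" "fmdom D' = fmdom D"
    "live_typing [] M' P' D'" "K \<subseteq> M'"
  using assms unfolding reduct_typing_def corr_iff by (metis req.simps(1))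

lemma reduct_typing_par:
  assumes "reduct_typing D a P'" and "live_typing [] M Q D2" and "disj D D2"
  shows "reduct_typing (D ++\<^sub>f D2) a (Par P' Q)" and "reduct_typing (D2 ++\<^sub>f D) a (Par Q P')"
proof -
  from assms(1) obtain d D' M' where r: "env_step D d D'" "corr d a" "fmdom D' = fmdom D"
      "live_typing [] M' P' D'" "req d \<subseteq> M'"
    by (auto simp: reduct_typing_def)
  have disj: "disj D' D2" using assms(3) r(3) disj_cong by metis
  have step: "env_step (D ++\<^sub>f D2) d (D' ++\<^sub>f D2)"
    using r(1) assms(3) disj by (rule env_step.intros)
  have dom: "fmdom (D' ++\<^sub>f D2) = fmdom (D ++\<^sub>f D2)" using r(3) by simp
  show "reduct_typing (D ++\<^sub>f D2) a (Par P' Q)"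
    using r(5) by (intro reduct_typingI[OF step r(2) dom live_typing.intros(5)[OF r(4) assms(2) disj]]) auto
  \<comment> \<open>Disjoint unions commute, so the step already built serves the mirrored
    composition too.\<close>
  have "D ++\<^sub>f D2 = D2 ++\<^sub>f D" "D' ++\<^sub>f D2 = D2 ++\<^sub>f D'" "disj D2 D'"
    using assms(3) disj fmadd_disj_commute disj_sym by metis+
  then show "reduct_typing (D2 ++\<^sub>f D) a (Par Q P')"
    using r(5) step dom by (intro reduct_typingI[OF _ r(2) _ live_typing.intros(5)[OF assms(2) r(4)]]) auto
qed

lemma reduct_typing_com:
  assumes "reduct_typing D1 (POut (dual k) v) P'" and "reduct_typing D2 (PIn k v) Q'" and "disj D1 D2"
  shows "reduct_typing (D1 ++\<^sub>f D2) PTau (Par P' Q')"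
    and "reduct_typing (D2 ++\<^sub>f D1) PTau (Par Q' P')"
proof -
  from assms obtain D1' M1 D2' M2 where
    r1: "env_step D1 (DAct (dual k) ROut) D1'" "fmdom D1' = fmdom D1" "live_typing [] M1 P' D1'" and
    r2: "env_step D2 (DAct k RIn) D2'" "fmdom D2' = fmdom D2" "live_typing [] M2 Q' D2'"
    by (metis reduct_typing_out reduct_typing_in)
  have disj: "disj D1' D2'" using assms(3) r1 r2 disj_cong by metis
  have step: "env_step (D1 ++\<^sub>f D2) DTau (D1' ++\<^sub>f D2')"
    using env_step.intros(3)[OF r1(1)] r2 assms(3) disj by simp
  show "reduct_typing (D1 ++\<^sub>f D2) PTau (Par P' Q')"
    using r1 r2 by (intro reduct_typingI[OF step _ _ live_typing.intros(5)[OF r1(3) r2(3) disj]])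
      (auto intro: corr.intros)
  have "D1 ++\<^sub>f D2 = D2 ++\<^sub>f D1" "D1' ++\<^sub>f D2' = D2' ++\<^sub>f D1'" "disj D2' D1'"
    using assms(3) disj fmadd_disj_commute disj_sym by metis+
  then show "reduct_typing (D2 ++\<^sub>f D1) PTau (Par Q' P')"
    using r1 r2 step by (intro reduct_typingI[of _ DTau, OF _ _ _ live_typing.intros(5)[OF r2(3) r1(3)]])
      (auto intro: corr.intros)
qed

text \<open>The synchronisation requests \<open>K1 \<union> K2\<close>. Each part is pending on its
  own side, and the typing of \<open>Par\<close> unites the pending sets.\<close>

lemma reduct_typing_sel:
  assumes "reduct_typing D1 (PSel (dual k) l) P'" and "reduct_typing D2 (PBra k l) Q'"
    and "disj D1 D2"
  shows "reduct_typing (D1 ++\<^sub>f D2) (PTauL l) (Par P' Q')"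
    and "reduct_typing (D2 ++\<^sub>f D1) (PTauL l) (Par Q' P')"
proof -
  from assms obtain K1 K2 D1' M1 D2' M2 where
    r1: "env_step D1 (DAct (dual k) (RSel l K1)) D1'" "fmdom D1' = fmdom D1"
      "live_typing [] M1 P' D1'" "K1 \<subseteq> M1" and
    r2: "env_step D2 (DAct k (RBra l K2)) D2'" "fmdom D2' = fmdom D2"
      "live_typing [] M2 Q' D2'" "K2 \<subseteq> M2"
    by (metis reduct_typing_select reduct_typing_branch)
  have disj: "disj D1' D2'" using assms(3) r1 r2 disj_cong by metis
  have step: "env_step (D1 ++\<^sub>f D2) (DTauL l (K1 \<union> K2)) (D1' ++\<^sub>f D2')"
    using env_step.intros(4)[OF r1(1)] r2 assms(3) disj by simp
  show "reduct_typing (D1 ++\<^sub>f D2) (PTauL l) (Par P' Q')"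
    using r1 r2 by (intro reduct_typingI[OF step _ _ live_typing.intros(5)[OF r1(3) r2(3) disj]])
      (auto intro: corr.intros)
  have "D1 ++\<^sub>f D2 = D2 ++\<^sub>f D1" "D1' ++\<^sub>f D2' = D2' ++\<^sub>f D1'" "disj D2' D1'"
    using assms(3) disj fmadd_disj_commute disj_sym by metis+
  then show "reduct_typing (D2 ++\<^sub>f D1) (PTauL l) (Par Q' P')"
    using r1 r2 step
    by (intro reduct_typingI[of _ "DTauL l (K1 \<union> K2)", OF _ _ _ live_typing.intros(5)[OF r2(3) r1(3)]])
      (auto intro: corr.intros)
qed

inductive_cases live_typing_elims:
  "live_typing G M (Send k e P) D"
  "live_typing G M (Recv k P) D"
  "live_typing G M (Select k l P) D"
  "live_typing G M (Branch k B) D"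
  "live_typing G M (Par P Q) D"
  "live_typing G M (Cond e P Q) D"

text \<open>The typing rules for selection and branching add the requested labels to the pending set
  of the continuation. Unfolding a recursion may enlarge the pending set, hence the generalisation
  over \<open>M\<close>.\<close>

lemma step_live_typing:
  "step eval P a W P' \<Longrightarrow> live_typing [] M P D \<Longrightarrow> reduct_typing D a P'"
proof (induction arbitrary: M D rule: step.induct)
  case (send e v k P)
  from send.prems show ?case
    by (auto elim!: live_typing_elims
        intro!: reduct_typingI env_step_fmupd ty_step.intros corr.intros)
next
  case (recv k P v)
  from recv.prems show ?case
    by (auto elim!: live_typing_elims intro: live_typing_dsub
        intro!: reduct_typingI env_step_fmupd ty_step.intros corr.intros)
next
  case (select k P l)
  from select.prems show ?case
    by (auto elim!: live_typing_elims
        intro!: reduct_typingI env_step_fmupd ty_step.intros corr.intros)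
next
  case (branch B l P k)
  from branch.prems obtain C D0 where C: "D = fmupd k (TBra C) D0" "fmdom B = fmdom C" "k |\<notin>| fmdom D0"
    and ty: "\<And>l P K T. fmlookup B l = Some P \<Longrightarrow> fmlookup C l = Some (K, T) \<Longrightarrow>
       live_typing [] ((M - {l}) \<union> K) P (fmupd k T D0)"
    by (auto elim!: live_typing_elims)
  obtain K T where "fmlookup C l = Some (K, T)"
    using C(2) branch.hyps(1) by (metis fmdomE fmdomI prod.exhaust)
  with C ty[OF branch.hyps(1)] show ?case
    by (auto intro!: reduct_typingI env_step_fmupd ty_step.intros corr.intros)
next
  case (par_left P a W Q P')
  from par_left.prems obtain M1 M2 D1 D2 where D: "D = D1 ++\<^sub>f D2"
      and d1: "disj D1 D2" and d2: "disj D2 D1"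
      and t1: "live_typing [] M1 P D1" and t2: "live_typing [] M2 P' D2"
    by (auto elim!: live_typing_elims simp: disj_sym)
  show ?case unfolding D by (rule reduct_typing_par(1)[OF par_left.IH[OF t1] t2 d1])
next
  case (par_right P a W Q P')
  from par_right.prems obtain M1 M2 D1 D2 where D: "D = D1 ++\<^sub>f D2"
      and d1: "disj D1 D2" and d2: "disj D2 D1"
      and t1: "live_typing [] M1 P' D1" and t2: "live_typing [] M2 P D2"
    by (auto elim!: live_typing_elims simp: disj_sym)
  show ?case unfolding D by (rule reduct_typing_par(2)[OF par_right.IH[OF t2] t1 d2])
next
  case (com_left P k v W P' Q V Q')
  from com_left.prems obtain M1 M2 D1 D2 where D: "D = D1 ++\<^sub>f D2"
      and d1: "disj D1 D2" and d2: "disj D2 D1"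
      and t1: "live_typing [] M1 P D1" and t2: "live_typing [] M2 Q D2"
    by (auto elim!: live_typing_elims simp: disj_sym)
  show ?case unfolding D by (rule reduct_typing_com(1)[OF com_left.IH(1)[OF t1] com_left.IH(2)[OF t2] d1])
next
  case (com_right P k v W P' Q V Q')
  from com_right.prems obtain M1 M2 D1 D2 where D: "D = D1 ++\<^sub>f D2"
      and d1: "disj D1 D2" and d2: "disj D2 D1"
      and t1: "live_typing [] M1 P D1" and t2: "live_typing [] M2 Q D2"
    by (auto elim!: live_typing_elims simp: disj_sym)
  show ?case unfolding D by (rule reduct_typing_com(2)[OF com_right.IH(2)[OF t2] com_right.IH(1)[OF t1] d2])
next
  case (sel_left P k l W P' Q V Q')
  from sel_left.prems obtain M1 M2 D1 D2 where D: "D = D1 ++\<^sub>f D2"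
      and d1: "disj D1 D2" and d2: "disj D2 D1"
      and t1: "live_typing [] M1 P D1" and t2: "live_typing [] M2 Q D2"
    by (auto elim!: live_typing_elims simp: disj_sym)
  show ?case unfolding D by (rule reduct_typing_sel(1)[OF sel_left.IH(1)[OF t1] sel_left.IH(2)[OF t2] d1])
next
  case (sel_right P k l W P' Q V Q')
  from sel_right.prems obtain M1 M2 D1 D2 where D: "D = D1 ++\<^sub>f D2"
      and d1: "disj D1 D2" and d2: "disj D2 D1"
      and t1: "live_typing [] M1 P D1" and t2: "live_typing [] M2 Q D2"
    by (auto elim!: live_typing_elims simp: disj_sym)
  show ?case unfolding D by (rule reduct_typing_sel(2)[OF sel_right.IH(2)[OF t2] sel_right.IH(1)[OF t1] d2])
next
  case (rec P a W Q)
  then show ?case by (blast elim: live_typing_unfold_rec)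
next
  case (brec_zero e Q a W Q' P)
  then show ?case by (blast elim: live_typing_unfold_brec)
next
  case (brec_Suc e n P Q a W P')
  then show ?case by (blast elim: live_typing_unfold_brec)
qed (auto elim!: live_typing_elims)

text \<open>\<open>add_label\<close> changes label sets only, so erasure turns all environments
  \<open>map (add_label l) G\<close> into the same one.\<close>

lemma live_typing_std_typing:
  "live_typing G M P D \<Longrightarrow>
    std_typing (map (\<lambda>E. case E of GenE A I D \<Rightarrow> D | BndE M D \<Rightarrow> D) G) P D"
proof -
  let ?env = "\<lambda>E. case E of GenE A I D \<Rightarrow> D | BndE M D \<Rightarrow> D"
  have erase: "?env (add_label l E) = ?env E" for l and E :: "('a, 'b) pentry"
    by (cases E) auto
  show "live_typing G M P D \<Longrightarrow> std_typing (map ?env G) P D"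
    by (induction rule: live_typing.induct) (auto intro: std_typing.intros simp: comp_def erase)
qed

section \<open>Inevitable labels\<close>

text \<open>However \<open>P\<close> is scheduled, one of its threads cannot keep running without eventually
  executing the label \<open>l\<close>.\<close>

inductive inevitable ::
    "(('o, 'a) expr \<Rightarrow> 'a val) \<Rightarrow> 'l \<Rightarrow> ('c, 'l, 'o, 'a) proc \<Rightarrow> bool"
  for eval :: "('o, 'a) expr \<Rightarrow> 'a val" and l :: 'l where
  Send: "inevitable eval l P \<Longrightarrow> inevitable eval l (Send k e P)"
| Recv: "(\<And>v. inevitable eval l (dsub P 0 v)) \<Longrightarrow> inevitable eval l (Recv k P)"
| Select: "(l' \<noteq> l \<Longrightarrow> inevitable eval l P) \<Longrightarrow> inevitable eval l (Select k l' P)"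
| Branch: "(\<And>l' P. fmlookup B l' = Some P \<Longrightarrow> l' \<noteq> l \<Longrightarrow> inevitable eval l P) \<Longrightarrow>
    inevitable eval l (Branch k B)"
| Par_left: "inevitable eval l P \<Longrightarrow> inevitable eval l (Par P Q)"
| Par_right: "inevitable eval l Q \<Longrightarrow> inevitable eval l (Par P Q)"
| Rec: "inevitable eval l (unfold_rec P) \<Longrightarrow> inevitable eval l (Rec P)"
| BRec: "(eval e = VNat 0 \<Longrightarrow> inevitable eval l Q) \<Longrightarrow>
    (\<And>n. eval e = VNat (Suc n) \<Longrightarrow> inevitable eval l (unfold_brec n P Q)) \<Longrightarrow>
    inevitable eval l (BRec e P Q)"
| Cond: "(eval e = VBool True \<Longrightarrow> inevitable eval l P) \<Longrightarrow>
    (eval e = VBool False \<Longrightarrow> inevitable eval l Q) \<Longrightarrow> inevitable eval l (Cond e P Q)"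

text \<open>The hypothesis for \<open>GenE\<close> is void when \<open>l \<notin> A\<close>, in particular on entering the recursion: a
  recursion variable can only be used with \<open>l\<close> pending if \<open>l \<in> I \<subseteq> A\<close>, and \<open>A\<close> does not gain \<open>l\<close> as
  long as \<open>l\<close> is not executed. This is what makes an induction on the typing derivation work for
  unbounded recursion.\<close>

fun inevitable_entry ::
    "(('o, 'a) expr \<Rightarrow> 'a val) \<Rightarrow> 'l \<Rightarrow> ('c, 'l) pentry \<Rightarrow> ('c, 'l, 'o, 'a) proc \<Rightarrow> bool" where
  "inevitable_entry eval l (GenE A I D) R \<longleftrightarrow> (l \<in> I \<longrightarrow> l \<in> A \<longrightarrow> inevitable eval l R)"
| "inevitable_entry eval l (BndE M' D) R \<longleftrightarrow> (l \<in> M' \<longrightarrow> inevitable eval l R)"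

text \<open>Labels other than \<open>l\<close> suffice: exchanging \<open>l\<close> itself ends that
  path of the game tree.\<close>

lemma inevitable_entry_add_label:
  "l' \<noteq> l \<Longrightarrow> inevitable_entry eval l (add_label l' E) R \<longleftrightarrow> inevitable_entry eval l E R"
  by (cases E) auto

text \<open>The first half allows terms closed by \<open>\<sigma>\<close> to be typed, and so to be
  added to it; the second is the hypothesis used when a recursion variable is reached.\<close>

abbreviation closes ::
    "(('o, 'a) expr \<Rightarrow> 'a val) \<Rightarrow> 'l \<Rightarrow> ('c, 'l) pentry list \<Rightarrow> ('c, 'l, 'o, 'a) proc list \<Rightarrow> bool" where
  "closes eval l G \<sigma> \<equiv> list_all2 entry_ok G \<sigma> \<and> list_all2 (inevitable_entry eval l) G \<sigma>"

lemma closes_add_label: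
  "closes eval l G \<sigma> \<Longrightarrow> l' \<noteq> l \<Longrightarrow> closes eval l (map (add_label l') G) \<sigma>"
  by (auto simp: list_all2_conv_all_nth inevitable_entry_add_label)

lemma list_all2_entry_ok_pclosed: "list_all2 entry_ok G \<sigma> \<Longrightarrow> \<forall>R\<in>set \<sigma>. pclosed R"
  by (induction rule: list_all2_induct) (auto intro: entry_ok_pclosed)

text \<open>Generalises inevitability to open terms so that induction on the typing derivation
  applies: process variables are closed by \<open>\<sigma>\<close>, data variables instantiated by
  \<open>xs\<close>. Exchanging \<open>l' \<noteq> l\<close> keeps \<open>l\<close> pending, and
  \<open>Inact\<close> admits no pending label.\<close>

lemma inevitable_closing:
  assumes "\<And>v. eval (EVal v) = v"
  shows "live_typing G M P D \<Longrightarrow> l \<in> M \<Longrightarrow> closes eval l G \<sigma> \<Longrightarrow>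
    inevitable eval l (closing 0 \<sigma> (dsubs xs P))"
proof (induction arbitrary: \<sigma> xs rule: live_typing.induct)
  case (1 G M P k T D e)
  then show ?case by (auto simp: closing_simps intro: inevitable.Send)
next
  case (2 G M P k T D)
  then show ?case
    by (auto simp: closing_simps dsub_closing dsubs_snoc intro!: inevitable.Recv)
next
  case (3 B C k D G M)
  have "inevitable eval l (closing 0 \<sigma> (dsubs xs P))"
    if l': "fmlookup B l' = Some P" "l' \<noteq> l" for l' P
  proof -
    obtain K T where "fmlookup C l' = Some (K, T)"
      using 3(1) l' by (metis fmdomE fmdomI prod.exhaust)
    with "3.IH"[OF l'(1), of K T \<sigma> xs] closes_add_label[OF "3.prems"(2) l'(2)] "3.prems"(1) l'(2)
    show ?thesis by simp
  qed
  then show ?case by (auto simp: closing_simps intro!: inevitable.Branch)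
next
  case (4 C l' K T k D G M P)
  have "inevitable eval l (closing 0 \<sigma> (dsubs xs P))" if "l' \<noteq> l"
    using "4.IH"[of \<sigma> xs] closes_add_label[OF "4.prems"(2) that] "4.prems"(1) that by simp
  then show ?case by (auto simp: closing_simps intro: inevitable.Select)
next
  case (5 G M1 P1 D1 M2 P2 D2)
  then show ?case
    by (auto simp: closing_simps intro: inevitable.Par_left inevitable.Par_right)
next
  case (6 D G)
  then show ?case by simp
next
  case (7 n G A I D M ks)
  \<comment> \<open>From \<open>l \<in> M\<close> follow \<open>l \<in> I\<close> and
    \<open>l \<in> A\<close>, so both premises of this entry hold.\<close>
  then have "inevitable_entry eval l (GenE A I D) (\<sigma> ! n)" "length G = length \<sigma>"
    by (metis list_all2_nthD, auto dest: list_all2_lengthD)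
  with 7 list_all2_entry_ok_pclosed[of G \<sigma>] show ?case
    using closing_PVar[of \<sigma> n 0 ks] by auto
next
  case (8 n G M' D M ks)
  then have "inevitable_entry eval l (BndE M' D) (\<sigma> ! n)" "length G = length \<sigma>"
    by (metis list_all2_nthD, auto dest: list_all2_lengthD)
  with 8 list_all2_entry_ok_pclosed[of G \<sigma>] show ?case
    using closing_PVar[of \<sigma> n 0 ks] by auto
next
  case (9 M' D G P Q M e)
  have pclosed: "\<forall>R\<in>set \<sigma>. pclosed R" using 9 list_all2_entry_ok_pclosed by blast
  define P' where "P' = closing 1 (dlifts \<sigma>) (dsubs (shift xs) P)"
  define Q' where "Q' = closing 0 \<sigma> (dsubs xs Q)"
  have Q': "inevitable eval l Q'"
    unfolding Q'_def using 9 by blast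
  have eq: "closing 0 \<sigma> (dsubs ys (BRec e' P Q)) =
      BRec (esubs ys e') (closing 1 (dlifts \<sigma>) (dsubs (shift ys) P)) (closing 0 \<sigma> (dsubs ys Q))"
    for ys e'
    using pclosed by (simp add: closing_Rec)
  have esubs_val: "esubs ys (EVal v) = EVal v" for ys v
    unfolding esubs_def by (induction ys) auto
  \<comment> \<open>One round of the loop: the copy with counter \<open>n\<close> is added to
    \<open>\<sigma>\<close> as the term for variable 0, so its inevitability passes to the
    unfolding.\<close>
  have unfold: "inevitable eval l (unfold_brec n P' Q')"
    if "inevitable eval l (BRec (EVal (VNat n)) P' Q')" for n
  proof -
    have "live_typing [] N (BRec (EVal (VNat n)) P' Q') D" if "N \<subseteq> M'" for N
    proof -
      have "live_typing G N (dsubs xs (BRec (EVal (VNat n)) P Q)) D"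
        using "9.hyps"(1,2) that by (intro live_typing_dsubs live_typing.intros(9))
      then show ?thesis
        using live_typing_closing[of G \<sigma> "[]"] "9.prems"(2) unfolding P'_def Q'_def
        by (metis append_Nil list.size(3) eq esubs_val)
    qed
    then have "entry_ok (BndE M' D) (BRec (EVal (VNat n)) P' Q')" by simp
    with 9 that have "closes eval l (BndE M' D # G) (BRec (EVal (VNat n)) P' Q' # \<sigma>)" by simp
    \<comment> \<open>Appending the counter makes it the last value substituted, at data variable 0
      as in \<open>unfold_brec\<close>.\<close>
    with 9 have "inevitable eval l (closing 0 (BRec (EVal (VNat n)) P' Q' # \<sigma>)
        (dsubs (shift xs @ [(0, VNat n)]) P))" by blast
    then show ?thesis
      by (simp add: unfold_brec_def P'_def dsub_closing dsubs_snoc)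
  qed
  \<comment> \<open>The literal bound evaluates to the counter by \<open>assms\<close>: 0 leads to
    \<open>Q'\<close>, a successor to the preceding copy.\<close>
  have "inevitable eval l (BRec (EVal (VNat n)) P' Q')" for n
    by (induction n) (auto simp: assms Q' unfold intro!: inevitable.BRec)
  then have "inevitable eval l (BRec (esubs xs e) P' Q')"
    using Q' unfold by (blast intro: inevitable.BRec)
  then show ?case using eq by (simp add: P'_def Q'_def)
next
  case (10 I D G P M)
  have pclosed: "\<forall>R\<in>set \<sigma>. pclosed R" using 10 list_all2_entry_ok_pclosed by blast
  define P' where "P' = closing 1 \<sigma> (dsubs xs P)"
  have eq: "closing 0 \<sigma> (dsubs xs (Rec P)) = Rec P'"
    using pclosed by (simp add: closing_Rec P'_def)
  have "live_typing [] N (Rec P') D" if "N \<subseteq> I" for N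
  proof -
    have "live_typing G N (dsubs xs (Rec P)) D"
      using "10.hyps"(1) that by (intro live_typing_dsubs live_typing.intros(10))
    then show ?thesis
      using live_typing_closing[of G \<sigma> "[]"] "10.prems"(2) by (metis append_Nil list.size(3) eq)
  qed
  then have "entry_ok (GenE {} I D) (Rec P')" by simp
  \<comment> \<open>With \<open>A\<close> empty the inevitability half is vacuous, which avoids a
    circular appeal to \<open>Rec P'\<close>.\<close>
  with 10 have "closes eval l (GenE {} I D # G) (Rec P' # \<sigma>)" by simp
  with 10 have "inevitable eval l (closing 0 (Rec P' # \<sigma>) (dsubs xs P))" by blast
  then have "inevitable eval l (unfold_rec P')"
    by (simp add: unfold_rec_def P'_def)
  then show ?case unfolding eq by (rule inevitable.Rec)
next
  case (11 G M P D Q e)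
  then show ?case by (auto simp: closing_simps intro: inevitable.Cond)
qed

lemma live_typing_inevitable:
  assumes "\<And>v. eval (EVal v) = v" and "live_typing [] M P D" and "l \<in> M"
  shows "inevitable eval l P"
  using inevitable_closing[where G = "[]" and \<sigma> = "[]" and xs = "[]", OF assms] by simp

section \<open>Threads of a process\<close>

text \<open>The relation stops anywhere among the recursions and conditionals in front of a thread, so
  that one address may lead to several terms, of which at most one is a prefixed process.\<close>

inductive thread ::
    "(('o, 'a) expr \<Rightarrow> 'a val) \<Rightarrow> ('c, 'l, 'o, 'a) proc \<Rightarrow> addr \<Rightarrow> ('c, 'l, 'o, 'a) proc \<Rightarrow> bool"
  for eval :: "('o, 'a) expr \<Rightarrow> 'a val" where
  refl: "thread eval P [] P"
| left: "thread eval P w R \<Longrightarrow> thread eval (Par P Q) (GoL # w) R"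
| right: "thread eval Q w R \<Longrightarrow> thread eval (Par P Q) (GoR # w) R"
| rec: "thread eval (unfold_rec P) w R \<Longrightarrow> thread eval (Rec P) w R"
| brec_zero: "eval e = VNat 0 \<Longrightarrow> thread eval Q w R \<Longrightarrow> thread eval (BRec e P Q) w R"
| brec_Suc: "eval e = VNat (Suc n) \<Longrightarrow> thread eval (unfold_brec n P Q) w R \<Longrightarrow>
    thread eval (BRec e P Q) w R"
| cond_true: "eval e = VBool True \<Longrightarrow> thread eval P w R \<Longrightarrow> thread eval (Cond e P Q) w R"
| cond_false: "eval e = VBool False \<Longrightarrow> thread eval Q w R \<Longrightarrow> thread eval (Cond e P Q) w R"

lemma thread_trans: "thread eval P w Q \<Longrightarrow> thread eval Q v R \<Longrightarrow> thread eval P (w @ v) R"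
  by (induction rule: thread.induct) (auto intro: thread.intros)

fun prefixed :: "('c, 'l, 'o, 'a) proc \<Rightarrow> bool" where
  "prefixed (Send k e P) \<longleftrightarrow> True"
| "prefixed (Recv k P) \<longleftrightarrow> True"
| "prefixed (Select k l P) \<longleftrightarrow> True"
| "prefixed (Branch k B) \<longleftrightarrow> True"
| "prefixed _ \<longleftrightarrow> False"

lemma thread_occ: "thread eval P w Q \<Longrightarrow> prefixed Q \<Longrightarrow> occ eval P w"
proof (induction rule: thread.induct)
  case (refl P)
  then show ?case by (cases P) (auto intro: occ.intros)
qed (auto intro: occ.intros)

inductive_cases top_sorted_elims:
  "top_sorted eval (Par P Q)"
  "top_sorted eval (Rec P)"
  "top_sorted eval (BRec e P Q)"
  "top_sorted eval (Cond e P Q)"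

lemma thread_top_sorted: "thread eval P w Q \<Longrightarrow> top_sorted eval P \<Longrightarrow> top_sorted eval Q"
  by (induction rule: thread.induct) (auto elim: top_sorted_elims)

inductive_cases thread_elims:
  "thread eval (Send k e P) w R"
  "thread eval (Recv k P) w R"
  "thread eval (Select k l P) w R"
  "thread eval (Branch k B) w R"
  "thread eval (Par P Q) w R"
  "thread eval (Rec P) w R"
  "thread eval (BRec e P Q) w R"
  "thread eval (Cond e P Q) w R"

text \<open>The counterpart of \<open>res\<close> on process transitions.\<close>

fun exchanged :: "('c, 'l, 'a) plabel \<Rightarrow> 'l option" where
  "exchanged (PSel k l) = Some l"
| "exchanged (PBra k l) = Some l"
| "exchanged (PTauL l) = Some l"
| "exchanged _ = None"

text \<open>The thread's own label \<open>b\<close> may differ from \<open>a\<close>, since a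
  synchronisation hides it, but both exchange the same label. The continuation stays at address
  \<open>w\<close>.\<close>

abbreviation advances ::
    "(('o, 'a) expr \<Rightarrow> 'a val) \<Rightarrow> ('c, 'l, 'a) plabel \<Rightarrow> ('c, 'l, 'o, 'a) proc \<Rightarrow> addr \<Rightarrow>
     ('c, 'l, 'o, 'a) proc \<Rightarrow> bool" where
  "advances eval a Q w P' \<equiv>
     \<exists>b Q'. step eval Q b {[]} Q' \<and> thread eval P' w Q' \<and> exchanged b = exchanged a"

lemma advances_Par:
  assumes "if u \<in> W then advances eval a Q u P' else thread eval P' u Q"
    and "exchanged a' = exchanged a"
  shows "GoL # u \<in> X \<longleftrightarrow> u \<in> W \<Longrightarrow>
      if GoL # u \<in> X then advances eval a' Q (GoL # u) (Par P' R)
      else thread eval (Par P' R) (GoL # u) Q"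
    and "GoR # u \<in> X \<longleftrightarrow> u \<in> W \<Longrightarrow>
      if GoR # u \<in> X then advances eval a' Q (GoR # u) (Par R P')
      else thread eval (Par R P') (GoR # u) Q"
  using assms by (metis thread.left thread.right)+

lemma thread_Par_cases:
  assumes "thread eval (Par P1 P2) w Q" and "prefixed Q"
  obtains u where "w = GoL # u" "thread eval P1 u Q" | u where "w = GoR # u" "thread eval P2 u Q"
  using assms by (auto elim: thread_elims)

text \<open>Transitions keep the parallel structure above a prefix, so addresses are stable. The
  dichotomy would fail for a parallel composition \<open>Q\<close>, whose parts move at longer
  addresses.\<close>

lemma thread_step:
  "step eval P a W P' \<Longrightarrow> thread eval P w Q \<Longrightarrow> prefixed Q \<Longrightarrow>
    (if w \<in> W then advances eval a Q w P' else thread eval P' w Q)"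
proof (induction arbitrary: w rule: step.induct)
  case (send e v k P)
  then show ?case by (fastforce elim: thread_elims intro: step.send thread.refl)
next
  case (recv k P v)
  then show ?case by (fastforce elim: thread_elims intro: step.recv thread.refl)
next
  case (select k P l)
  then show ?case by (fastforce elim: thread_elims intro: step.select thread.refl)
next
  case (branch B l P k)
  then show ?case by (fastforce elim: thread_elims intro: step.branch thread.refl)
next
  case (rec P a W Q')
  from rec.prems have "thread eval (unfold_rec P) w Q" by (auto elim: thread_elims)
  with rec show ?case by blast
next
  case (brec_zero e Q1 a W Q' P)
  from brec_zero.prems brec_zero.hyps(1) have "thread eval Q1 w Q" by (auto elim: thread_elims)
  with brec_zero show ?case by blast
next
  case (brec_Suc e n P Q1 a W P')
  from brec_Suc.prems brec_Suc.hyps(1) have "thread eval (unfold_brec n P Q1) w Q"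
    by (auto elim: thread_elims)
  with brec_Suc show ?case by blast
next
  case (cond_true e P a W P' Q1)
  from cond_true.prems cond_true.hyps(1) have "thread eval P w Q" by (auto elim: thread_elims)
  with cond_true show ?case by blast
next
  case (cond_false e Q1 a W Q' P)
  from cond_false.prems cond_false.hyps(1) have "thread eval Q1 w Q" by (auto elim: thread_elims)
  with cond_false show ?case by blast
next
  case (par_left P a W P' P2)
  from par_left.prems show ?case
  proof (cases rule: thread_Par_cases)
    case (1 u)
    show ?thesis unfolding 1(1)
      by (rule advances_Par(1)[OF par_left.IH[OF 1(2)]]) (use par_left.prems in auto)
  next
    case (2 u)
    show ?thesis unfolding 2(1)
      using 2(2) by (auto intro: thread.right)
  qed
next
  case (par_right P a W P' P2)
  from par_right.prems show ?case
  proof (cases rule: thread_Par_cases)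
    case (1 u)
    show ?thesis unfolding 1(1)
      using 1(2) by (auto intro: thread.left)
  next
    case (2 u)
    show ?thesis unfolding 2(1)
      by (rule advances_Par(2)[OF par_right.IH[OF 2(2)]]) (use par_right.prems in auto)
  qed
next
  case (com_left P k v W P' Q1 V Q')
  from com_left.prems show ?case
  proof (cases rule: thread_Par_cases)
    case (1 u)
    show ?thesis unfolding 1(1)
      by (rule advances_Par(1)[OF com_left.IH(1)[OF 1(2)]]) (use com_left.prems in auto)
  next
    case (2 u)
    show ?thesis unfolding 2(1)
      by (rule advances_Par(2)[OF com_left.IH(2)[OF 2(2)]]) (use com_left.prems in auto)
  qed
next
  case (com_right P k v W P' Q1 V Q')
  from com_right.prems show ?case
  proof (cases rule: thread_Par_cases)
    case (1 u)
    show ?thesis unfolding 1(1)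
      by (rule advances_Par(1)[OF com_right.IH(1)[OF 1(2)]]) (use com_right.prems in auto)
  next
    case (2 u)
    show ?thesis unfolding 2(1)
      by (rule advances_Par(2)[OF com_right.IH(2)[OF 2(2)]]) (use com_right.prems in auto)
  qed
next
  case (sel_left P k l W P' Q1 V Q')
  from sel_left.prems show ?case
  proof (cases rule: thread_Par_cases)
    case (1 u)
    show ?thesis unfolding 1(1)
      by (rule advances_Par(1)[OF sel_left.IH(1)[OF 1(2)]]) (use sel_left.prems in auto)
  next
    case (2 u)
    show ?thesis unfolding 2(1)
      by (rule advances_Par(2)[OF sel_left.IH(2)[OF 2(2)]]) (use sel_left.prems in auto)
  qed
next
  case (sel_right P k l W P' Q1 V Q')
  from sel_right.prems show ?case
  proof (cases rule: thread_Par_cases)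
    case (1 u)
    show ?thesis unfolding 1(1)
      by (rule advances_Par(1)[OF sel_right.IH(1)[OF 1(2)]]) (use sel_right.prems in auto)
  next
    case (2 u)
    show ?thesis unfolding 2(1)
      by (rule advances_Par(2)[OF sel_right.IH(2)[OF 2(2)]]) (use sel_right.prems in auto)
  qed
qed

section \<open>Maximal sequences\<close>

text \<open>Lock-freedom makes the address be executed; at the first such moment \<open>j\<close> it
  still holds \<open>Q\<close>, by \<open>thread_step\<close>.\<close>

lemma thread_executed:
  assumes steps: "\<And>i. enat i < N \<Longrightarrow> step eval (Ps i) (as i) (Ws i) (Ps (Suc i))"
    and lf: "lock_free_seq eval N Ps Ws"
    and i: "enat i \<le> N" and thread: "thread eval (Ps i) w Q" and prefixed: "prefixed Q"
  shows "\<exists>j\<ge>i. enat j < N \<and> advances eval (as j) Q w (Ps (Suc j))"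
proof -
  define p where "p j \<longleftrightarrow> i \<le> j \<and> enat j < N \<and> w \<in> Ws j" for j
  obtain j0 where "p j0"
    using lf i thread_occ[OF thread prefixed] unfolding lock_free_seq_def p_def by blast
  define j where "j = (LEAST j. p j)"
  have j: "i \<le> j" "enat j < N" "w \<in> Ws j"
    using LeastI[of p, OF \<open>p j0\<close>] unfolding j_def p_def by blast+
  have "thread eval (Ps m) w Q" if "i \<le> m" "m \<le> j" for m
    using that
  proof (induction m rule: dec_induct)
    case (step m)
    have m: "enat m < N" using step.prems j(2) by (meson Suc_le_eq enat_ord_simps(2) order.strict_trans)
    have "w \<notin> Ws m"
      using not_less_Least[of m p] step m unfolding j_def[symmetric] by (auto simp: p_def)
    then show ?case
      using thread_step[OF steps[OF m] _ prefixed] step by simp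
  qed (rule thread)
  then have "thread eval (Ps j) w Q" using j(1) by blast
  then have "advances eval (as j) Q w (Ps (Suc j))"
    using thread_step[OF steps[OF j(2)] _ prefixed] j(3) by simp
  with j show ?thesis by blast
qed

inductive_cases prefix_step_elims:
  "step eval (Send k e P) b W Q"
  "step eval (Recv k P) b W Q"
  "step eval (Select k l P) b W Q"
  "step eval (Branch k B) b W Q"

text \<open>The run traces a path through the well-founded tree. At a prefix it advances to the
  moment the thread executes it; at the other constructors no time passes and only the view of the
  thread changes.\<close>

lemma inevitable_exchanged:
  assumes steps: "\<And>i. enat i < N \<Longrightarrow> step eval (Ps i) (as i) (Ws i) (Ps (Suc i))"
    and lf: "lock_free_seq eval N Ps Ws"
    and sorted: "\<And>i. enat i \<le> N \<Longrightarrow> top_sorted eval (Ps i)"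
  shows "inevitable eval l Q \<Longrightarrow> enat i \<le> N \<Longrightarrow> thread eval (Ps i) w Q \<Longrightarrow>
    \<exists>j\<ge>i. enat j < N \<and> exchanged (as j) = Some l"
proof (induction arbitrary: i w rule: inevitable.induct)
  \<comment> \<open>Common to the four prefix cases: the executed prefix either exchanges
    \<open>l\<close> or leads to a subtree, entered at state \<open>Suc j\<close>.\<close>
  have follow: "\<exists>j\<ge>i. enat j < N \<and> exchanged (as j) = Some l"
    if Q: "enat i \<le> N" "thread eval (Ps i) w Q" "prefixed Q"
      and IH: "\<And>b Q' i. step eval Q b {[]} Q' \<Longrightarrow> exchanged b \<noteq> Some l \<Longrightarrow> enat i \<le> N \<Longrightarrow>
        thread eval (Ps i) w Q' \<Longrightarrow> \<exists>j\<ge>i. enat j < N \<and> exchanged (as j) = Some l"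
    for i w Q
  proof -
    obtain j b Q' where j: "i \<le> j" "enat j < N" "step eval Q b {[]} Q'"
        "thread eval (Ps (Suc j)) w Q'" "exchanged b = exchanged (as j)"
      using thread_executed[OF steps lf Q] by blast
    show ?thesis
    proof (cases "exchanged b = Some l")
      case True
      with j show ?thesis by auto
    next
      case False
      have "enat (Suc j) \<le> N" using j(2) by (simp add: Suc_ile_eq)
      with IH[OF j(3) False _ j(4)] j(1) show ?thesis by (meson Suc_leD le_trans)
    qed
  qed
  {
    case (Send P k e)
    show ?case
      by (rule follow[OF Send.prems]) (auto elim!: prefix_step_elims intro: Send.IH)
  next
    case (Recv P k)
    show ?case
      by (rule follow[OF Recv.prems]) (auto elim!: prefix_step_elims intro: Recv.IH)
  next
    case (Select l' P k)
    show ?case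
      by (rule follow[OF Select.prems]) (auto elim!: prefix_step_elims intro: Select.IH)
  next
    case (Branch B k)
    show ?case
      by (rule follow[OF Branch.prems]) (auto elim!: prefix_step_elims intro: Branch.IH)
  next
    case (Par_left P Q)
    then show ?case using thread_trans thread.left[OF thread.refl] by blast
  next
    case (Par_right Q P)
    then show ?case using thread_trans thread.right[OF thread.refl] by blast
  next
    case (Rec P)
    then show ?case using thread_trans thread.rec[OF thread.refl] by blast
  next
    case (BRec e Q P)
    \<comment> \<open>Sortedness excludes other values of \<open>e\<close>, for which both premises
      of \<open>BRec\<close> would be void.\<close>
    have "top_sorted eval (BRec e P Q)"
      using thread_top_sorted sorted BRec.prems by blast
    then consider "eval e = VNat 0" | n where "eval e = VNat (Suc n)"
      by (auto elim: top_sorted_elims)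
    then show ?case
    proof cases
      case 1
      then have "thread eval (BRec e P Q) [] Q" by (intro thread.brec_zero thread.refl)
      from BRec.IH(1)[OF 1 BRec.prems(1) thread_trans[OF BRec.prems(2) this]] show ?thesis .
    next
      case (2 n)
      then have "thread eval (BRec e P Q) [] (unfold_brec n P Q)"
        by (rule thread.brec_Suc) (rule thread.refl)
      from BRec.IH(2)[OF 2 BRec.prems(1) thread_trans[OF BRec.prems(2) this]] show ?thesis .
    qed
  next
    case (Cond e P Q)
    have "top_sorted eval (Cond e P Q)"
      using thread_top_sorted sorted Cond.prems by blast
    then consider "eval e = VBool True" | "eval e = VBool False"
      by (auto elim: top_sorted_elims)
    then show ?case
    proof cases
      case 1
      then have "thread eval (Cond e P Q) [] P" by (intro thread.cond_true thread.refl)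
      from Cond.IH(1)[OF 1 Cond.prems(1) thread_trans[OF Cond.prems(2) this]] show ?thesis .
    next
      case 2
      then have "thread eval (Cond e P Q) [] Q" by (intro thread.cond_false thread.refl)
      from Cond.IH(2)[OF 2 Cond.prems(1) thread_trans[OF Cond.prems(2) this]] show ?thesis .
    qed
  }
qed

lemma corr_res: "corr d a \<Longrightarrow> exchanged a = Some l \<Longrightarrow> res d = {l}"
  by (cases rule: corr.cases) auto

lemma trans_seq_top_sorted:
  assumes "well_sorted eval P" and "trans_seq eval P N Ps as Ws" and "enat i \<le> N"
  shows "top_sorted eval (Ps i)"
proof -
  have "(\<lambda>P Q. \<exists>a. ptrans eval P a Q)\<^sup>*\<^sup>* P (Ps i)"
    using assms(3)
  proof (induction i)
    case 0
    then show ?case using assms(2) by (simp add: trans_seq_def)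
  next
    case (Suc i)
    then have i: "enat i < N" by (simp add: Suc_ile_eq)
    then have "\<exists>a. ptrans eval (Ps i) a (Ps (Suc i))"
      using assms(2) unfolding trans_seq_def ptrans_def by blast
    with Suc.IH i show ?case by (simp add: rtranclp.rtrancl_into_rtrancl order.strict_implies_order)
  qed
  with assms(1) show ?thesis by (simp add: well_sorted_def)
qed

text \<open>Subject reduction iterated by dependent choice, as each environment depends on the one
  chosen before.\<close>

lemma trans_seq_live_typing:
  fixes M :: "'l set"
  assumes "live_typing [] M P D" and "trans_seq eval P N Ps as Ws"
  obtains Ds Ms ds where "Ds 0 = D" "\<And>i. enat i \<le> N \<Longrightarrow> live_typing [] (Ms i) (Ps i) (Ds i)"
    "\<And>i. enat i < N \<Longrightarrow> env_step (Ds i) (ds i) (Ds (Suc i))"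
    "\<And>i. enat i < N \<Longrightarrow> corr (ds i) (as i)"
    "\<And>i. enat i < N \<Longrightarrow> req (ds i) \<subseteq> Ms (Suc i)"
proof -
  \<comment> \<open>The guard is void beyond \<open>N\<close>, so an infinite sequence can be chosen
    even for a finite run.\<close>
  define inv where "inv i = (\<lambda>(M', D'). enat i \<le> N \<longrightarrow> live_typing [] M' (Ps i) D')" for i
  define next_ok where "next_ok i = (\<lambda>(M1 :: 'l set, D1) (M2 :: 'l set, D2). enat i < N \<longrightarrow>
      (\<exists>d. env_step D1 d D2 \<and> corr d (as i) \<and> req d \<subseteq> M2))" for i
  have "\<exists>y. inv (Suc i) y \<and> next_ok i x y" if "inv i x" for i x
  proof (cases "enat i < N")
    case True
    with that have "live_typing [] (fst x) (Ps i) (snd x)" by (simp add: inv_def case_prod_unfold)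
    moreover have "step eval (Ps i) (as i) (Ws i) (Ps (Suc i))"
      using assms(2) True by (simp add: trans_seq_def)
    ultimately have "reduct_typing (snd x) (as i) (Ps (Suc i))" by (rule step_live_typing[rotated])
    then show ?thesis
      unfolding reduct_typing_def inv_def next_ok_def by fastforce
  next
    case False
    then show ?thesis by (simp add: inv_def next_ok_def case_prod_unfold Suc_ile_eq)
  qed
  moreover have "inv 0 (M, D)" using assms by (simp add: inv_def trans_seq_def)
  ultimately obtain f where f: "f 0 = (M, D)" "\<And>i. inv i (f i)" "\<And>i. next_ok i (f i) (f (Suc i))"
    \<comment> \<open>The conjunct for \<open>i = 0\<close> pins the first element of the
      sequence.\<close>
    using dependent_nat_choice[of "\<lambda>i x. inv i x \<and> (i = 0 \<longrightarrow> x = (M, D))" next_ok]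
    by (metis nat.distinct(1))
  have "\<exists>d. enat i < N \<longrightarrow> env_step (snd (f i)) d (snd (f (Suc i))) \<and> corr d (as i) \<and>
      req d \<subseteq> fst (f (Suc i))" for i
    using f(3)[of i] by (auto simp: next_ok_def case_prod_unfold)
  then obtain ds where ds: "\<And>i. enat i < N \<Longrightarrow> env_step (snd (f i)) (ds i) (snd (f (Suc i))) \<and>
      corr (ds i) (as i) \<and> req (ds i) \<subseteq> fst (f (Suc i))"
    by metis
  show thesis
  proof (rule that)
    show "snd (f 0) = D" by (simp add: f(1))
    show "live_typing [] (fst (f i)) (Ps i) (snd (f i))" if "enat i \<le> N" for i
      using f(2)[of i] that by (simp add: inv_def case_prod_unfold)
  qed (use ds in blast)+
qed

theorem theorem6p19:
  fixes eval :: "('o, 'a) expr \<Rightarrow> 'a val"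
    and M :: "'l::{countable, infinite} set"
    and P :: "('c, 'l, 'o, 'a) proc"
    and \<Delta> :: "('c, 'l) senv"
  assumes eval_val: "\<And>v. eval (EVal v) = v"
    and wf: "wf_proc P"
    and sorted: "well_sorted eval P"
    and types: "\<And>k T. fmlookup \<Delta> k = Some T \<Longrightarrow> is_type T"
    and typing: "live_typing [] M P \<Delta>"
    and lf: "lock_free eval P"
  shows "live_proc eval [] \<Delta> P"
  unfolding live_proc_def
proof (intro allI impI)
  fix N Ps as Ws
  assume seq: "trans_seq eval P N Ps as Ws" and max: "maximal eval N Ps Ws"
  have lfs: "lock_free_seq eval N Ps Ws" using lf seq max by (auto simp: lock_free_def)
  have steps: "\<And>i. enat i < N \<Longrightarrow> step eval (Ps i) (as i) (Ws i) (Ps (Suc i))"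
    using seq by (simp add: trans_seq_def)
  show "\<exists>Ds ds. env_seq \<Delta> N Ds ds \<and> live N ds \<and> typed_seq eval [] P \<Delta> N Ps Ds as ds"
  proof (rule trans_seq_live_typing[OF typing seq])
    fix Ds Ms ds
    assume D0: "Ds 0 = \<Delta>"
      and typed: "\<And>i. enat i \<le> N \<Longrightarrow> live_typing [] (Ms i) (Ps i) (Ds i)"
      and env: "\<And>i. enat i < N \<Longrightarrow> env_step (Ds i) (ds i) (Ds (Suc i))"
      and corr: "\<And>i. enat i < N \<Longrightarrow> corr (ds i) (as i)"
      and req: "\<And>i. enat i < N \<Longrightarrow> req (ds i) \<subseteq> Ms (Suc i)"
    have "live N ds"
      unfolding live_def
    proof (intro allI impI subsetI)
      fix n l
      assume n: "enat n < N" and l: "l \<in> req (ds n)"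
      \<comment> \<open>The label is pending only in the target of transition \<open>n\<close>;
        starting from state \<open>Suc n\<close> also gives the strict \<open>n < m\<close> in
        \<open>live\<close>.\<close>
      have n': "enat (Suc n) \<le> N" using n by (simp add: Suc_ile_eq)
      have "inevitable eval l (Ps (Suc n))"
        by (rule live_typing_inevitable[OF eval_val typed[OF n']]) (use req[OF n] l in blast)
      have "\<exists>j\<ge>Suc n. enat j < N \<and> exchanged (as j) = Some l"
        by (rule inevitable_exchanged[OF steps lfs trans_seq_top_sorted[OF sorted seq]
              \<open>inevitable eval l (Ps (Suc n))\<close> n' thread.refl])
      then obtain j where j: "Suc n \<le> j" "enat j < N" "exchanged (as j) = Some l" by blast
      have "res (ds j) = {l}" by (rule corr_res[OF corr[OF j(2)] j(3)])
      with j show "l \<in> (\<Union>m\<in>{m. n < m \<and> enat m < N}. res (ds m))"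
        by (intro UN_I[of j]) auto
    qed
    moreover have std: "std_typing [] (Ps i) (Ds i)" if "enat i \<le> N" for i
      using live_typing_std_typing[OF typed[OF that]] by simp
    have "typed_step eval [] (Ps i) (Ds i) (as i) (ds i) (Ps (Suc i)) (Ds (Suc i))"
      if i: "enat i < N" for i
    proof -
      have "enat (Suc i) \<le> N" using i by (simp add: Suc_ile_eq)
      then show ?thesis
        unfolding typed_step_def ptrans_def
        using std[OF order.strict_implies_order[OF i]] std steps[OF i] env[OF i] corr[OF i] by auto
    qed
    then have "typed_seq eval [] P \<Delta> N Ps Ds as ds"
      using seq D0 std[of 0] by (simp add: typed_seq_def trans_seq_def zero_enat_def[symmetric])
    moreover have "env_seq \<Delta> N Ds ds"
      using D0 env by (simp add: env_seq_def)
    ultimately show ?thesis by blast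
  qed
qed

end
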